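(* Consider the infinite horizon time-homogeneous system described in the context with performance criterion $$\mathcal J(c,g,l)=\mathbb E\Big\{\sum_{t=1}^\infty\beta^{t-1}\rho(X_t,\widehat X_t)\Big\},\qquad \beta\in(0,1).$$ The evolution of the value functions $V_t:\Pi\to\mathbb R^+$, $\widehat V_t:\Phi\to\mathbb R^+$ ($t\ge1$; the optimal discounted costs-to-go defined in the context) is governed by $$V_t=\mathcal W\widehat V_t,\qquad \widehat V_t=\widehat{\mathcal W}V_{t+1},\qquad t\ge 1.$$ Moreover, the arguments that minimize at each stage determine the decision rules $c_t$ and $l_t$: if $c=(c_1,c_2,\dots)$, $c_t\in\mathscr C_S$, and $l=(l_1,l_2,\dots)$, $l_t\in\mathscr L$, are such that, along the trajectory started from $\pi_1$ given by $\varphi_t=Q(c_t)\pi_t$, $\pi_{t+1}=\widehat Q(l_t)\varphi_t$, the rule $c_t$ attains the infimum in $(\mathcal W\widehat V_t)(\pi_t)$ and $l_t$ attains the infimum in $(\widehat{\mathcal W}V_{t+1})(\varphi_t)$ for every $t\ge1$, then $(c,l)$ minimizes $\sum_{t=1}^\infty\beta^{t-1}\tilde\rho(\varphi_t)$, i.e. minimizes $\mathcal J(c,g^*(c,l),l)$, over all sequences of rules in $\mathscr C_S$ and $\mathscr L$.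
   Context: System. $\mathcal X,\mathcal Z,\mathcal Y,\mathcal M$ are finite sets, $\mathcal M=\{1,\dots,|\mathcal M|\}$. $(X_t)_{t\ge1}$ is a time-homogeneous Markov chain on $\mathcal X$ with given law of $X_1$ and transition probabilities $P_X(x'\mid x)$. The encoder sends $Z_t\in\mathcal Z$ through a time-invariant discrete memoryless channel with outputs $Y_t\in\mathcal Y$ and transition probabilities $P(y,z)=\Pr(Y_t=y\mid Z_t=z)$ (given $X^t,Z^t,Y^{t-1}$, $Y_t$ has law $P(\cdot,Z_t)$, and the source evolves independently of the channel noise). The receiver's memory has $M_0=1$ and $M_t=l_t(Y_t,M_{t-1})\in\mathcal M$, and the receiver outputs $\widehat X_t=g_t(Y_t,M_{t-1})\in\mathcal X$. The distortion $\rho:\mathcal X\times\mathcal X\to[0,\infty)$ does not depend on time. For a finite set $S$, $\mathcal P^S$ is the simplex of probability mass functions on $S$. $\mathscr L$ is the set of functions $\mathcal Y\times\mathcal M\to\mathcal M$; $\mathscr C_S$ is the set of (Borel measurable) functions $\mathcal X\times\mathcal P^{\mathcal M}\to\mathcal Z$, used as $Z_t=c_t(X_t,P_{M_{t-1}})$, where $P_{M_t}(m)=\Pr(M_t=m\mid X^t,Z^t,c^t,l^t)$ is the encoder's belief about the memory under the fixed rules ($P_{M_0}$ is the point mass at $1$). For given $(c,l)$, $g^*(c,l)=(g^*_t)_{t\ge1}$ is an optimal decoder: $g_t^*(y,m)\in\arg\min_{\hat x}\sum_x\rho(x,\hat x)\Pr(X_t=x\mid Y_t=y,M_{t-1}=m)$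 (arbitrary where the conditioning event has probability zero). $\Pi$ (resp. $\Phi$) is the space of Borel probability measures on $\mathcal X\times\mathcal P^{\mathcal M}$ (resp. $\mathcal X\times\mathcal P^{\mathcal Y\times\mathcal M}$). Put $\nu(p,z)(y,m)=P(y,z)p(m)$ for $p\in\mathcal P^{\mathcal M}$, and $\psi(q,l)(m')=\sum_{(y,m):\,l(y,m)=m'}q(y,m)$ for $q\in\mathcal P^{\mathcal Y\times\mathcal M}$. For $c\in\mathscr C_S$, $Q(c)\pi\in\Phi$ is the image of $\pi\in\Pi$ under $(x,p)\mapsto(x,\nu(p,c(x,p)))$. For $l\in\mathscr L$, $\widehat Q(l)\varphi\in\Pi$ is the law of $(X',\psi(q,l))$ when $(x,q)\sim\varphi\in\Phi$ and, given $(x,q)$, $X'\sim P_X(\cdot\mid x)$. Put $\tilde\rho(\varphi)=\sum_{y,m}\min_{\hat x\in\mathcal X}\int\rho(x,\hat x)\,q(y,m)\,\varphi(dx,dq)$. $\pi_1$ is the law of $(X_1,P_{M_0})$. Operators. For functions $\widehat V:\Phi\to\mathbb R^+=[0,\infty)$ and $V:\Pi\to\mathbb R^+$: $$(W(c)\widehat V)(\pi)=\tilde\rho(Q(c)\pi)+\beta\,\widehat V(Q(c)\pi),\qquad(\widehat W(l)V)(\varphi)=V(\widehat Q(l)\varphi),$$ $$(\mathcal W\widehat V)(\pi)=\inf_{c\in\mathscr C_S}(W(c)\widehat V)(\pi),\qquad(\widehat{\mathcal W}V)(\varphi)=\inf_{l\in\mathscr L}(\widehat W(l)V)(\varphi).$$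 Value functions. $V_t(\pi)$ is the infimum of $\sum_{s=t}^\infty\beta^{s-t}\tilde\rho(\varphi_s)$ over $c_t,c_{t+1},\dots\in\mathscr C_S$ and $l_t,l_{t+1},\dots\in\mathscr L$, where $\pi_t=\pi$, $\varphi_s=Q(c_s)\pi_s$, $\pi_{s+1}=\widehat Q(l_s)\varphi_s$ for $s\ge t$. $\widehat V_t(\varphi)$ is the infimum of $\sum_{s=t+1}^\infty\beta^{s-t-1}\tilde\rho(\varphi_s)$ over $l_t,l_{t+1},\dots\in\mathscr L$ and $c_{t+1},c_{t+2},\dots\in\mathscr C_S$, where $\varphi_t=\varphi$, $\pi_{s+1}=\widehat Q(l_s)\varphi_s$ for $s\ge t$ and $\varphi_s=Q(c_s)\pi_s$ for $s\ge t+1$. *)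

theory Defs
  imports "HOL-Probability.Probability"
begin

text \<open>
  The alphabets are finite types \<open>'x\<close> (source), \<open>'z\<close> (channel input), \<open>'y\<close> (channel output) and
  \<open>'m\<close> (memory); \<open>m0 :: 'm\<close> is the initial memory content (the element \<open>1\<close> of
  \<open>{1, ..., |M|}\<close>).  Throughout, \<open>muX\<close> is the law of the first source symbol,
  \<open>PX x\<close> is the law \<open>P_X( . | x)\<close>, \<open>chan z\<close> is the law \<open>P( . , z)\<close>, \<open>\<rho>\<close> is the distortion
  and \<open>\<beta>\<close> the discount factor.  Times are the natural numbers \<open>t \<ge> 1\<close>.
\<close>

section \<open>Beliefs and information states\<close>

definition prob_simplex :: "(real ^ 'n::finite) set" where
  "prob_simplex = {p. (\<forall>i. 0 \<le> p $ i) \<and> (\<Sum>i\<in>UNIV. p $ i) = 1}"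

text \<open>The Borel space \<open>X \<times> P\<^sup>S\<close>, for \<open>S = M\<close> or \<open>S = Y \<times> M\<close>.\<close>

definition belief_space :: "('x::finite \<times> (real ^ 'n::finite)) measure" where
  "belief_space = count_space UNIV \<Otimes>\<^sub>M restrict_space borel prob_simplex"

text \<open>The probability measures on \<open>belief_space\<close>: this is \<open>\<Pi>\<close> for \<open>'n = 'm\<close> and
  \<open>\<Phi>\<close> for \<open>'n = 'y \<times> 'm\<close>.\<close>

definition info_states :: "('x::finite \<times> (real ^ 'n::finite)) measure set" where
  "info_states = space (prob_algebra belief_space)"

definition enc_rules :: "('x::finite \<times> (real ^ 'm::finite) \<Rightarrow> 'z::finite) set" where
  "enc_rules = belief_space \<rightarrow>\<^sub>M count_space UNIV"

definition init_state ::
  "'x::finite pmf \<Rightarrow> 'm::finite \<Rightarrow> ('x \<times> (real ^ 'm)) measure" where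
  "init_state muX m0 = distr (measure_pmf muX) belief_space (\<lambda>x. (x, axis m0 1))"

section \<open>Evolution of the information states\<close>

definition nu ::
  "('z::finite \<Rightarrow> 'y::finite pmf) \<Rightarrow> (real ^ 'm::finite) \<Rightarrow> 'z \<Rightarrow> (real ^ ('y \<times> 'm))" where
  "nu chan p z = (\<chi> ym. pmf (chan z) (fst ym) * p $ snd ym)"

definition psi ::
  "(real ^ ('y::finite \<times> 'm::finite)) \<Rightarrow> ('y \<times> 'm \<Rightarrow> 'm) \<Rightarrow> (real ^ 'm)" where
  "psi q l = (\<chi> m'. \<Sum>ym | l ym = m'. q $ ym)"

definition Q ::
  "('z::finite \<Rightarrow> 'y::finite pmf) \<Rightarrow> ('x::finite \<times> (real ^ 'm::finite) \<Rightarrow> 'z)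
    \<Rightarrow> ('x \<times> (real ^ 'm)) measure \<Rightarrow> ('x \<times> (real ^ ('y \<times> 'm))) measure" where
  "Q chan c \<pi> = distr \<pi> belief_space (\<lambda>(x, p). (x, nu chan p (c (x, p))))"

definition Qhat ::
  "('x::finite \<Rightarrow> 'x pmf) \<Rightarrow> ('y::finite \<times> 'm::finite \<Rightarrow> 'm)
    \<Rightarrow> ('x \<times> (real ^ ('y \<times> 'm))) measure \<Rightarrow> ('x \<times> (real ^ 'm)) measure" where
  "Qhat PX l \<phi> =
     \<phi> \<bind> (\<lambda>(x, q). distr (measure_pmf (PX x)) belief_space (\<lambda>x'. (x', psi q l)))"

definition rho_tilde ::
  "('x::finite \<Rightarrow> 'x \<Rightarrow> real) \<Rightarrow> ('x \<times> (real ^ ('y::finite \<times> 'm::finite))) measure \<Rightarrow> real" where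
  "rho_tilde \<rho> \<phi> =
     (\<Sum>ym\<in>UNIV. MIN xh\<in>UNIV. \<integral>(x, q). \<rho> x xh * q $ ym \<partial>\<phi>)"

section \<open>Dynamic programming operators\<close>

text \<open>All infima below are over nonempty sets of reals that are bounded below by 0 when \<open>\<rho>\<close> and
  the value functions are nonnegative.\<close>

definition W ::
  "('z::finite \<Rightarrow> 'y::finite pmf) \<Rightarrow> ('x::finite \<Rightarrow> 'x \<Rightarrow> real) \<Rightarrow> real
    \<Rightarrow> ('x \<times> (real ^ 'm::finite) \<Rightarrow> 'z) \<Rightarrow> (('x \<times> (real ^ ('y \<times> 'm))) measure \<Rightarrow> real)
    \<Rightarrow> ('x \<times> (real ^ 'm)) measure \<Rightarrow> real" where
  "W chan \<rho> \<beta> c Vh \<pi> = rho_tilde \<rho> (Q chan c \<pi>) + \<beta> * Vh (Q chan c \<pi>)"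

definition What ::
  "('x::finite \<Rightarrow> 'x pmf) \<Rightarrow> ('y::finite \<times> 'm::finite \<Rightarrow> 'm)
    \<Rightarrow> (('x \<times> (real ^ 'm)) measure \<Rightarrow> real) \<Rightarrow> ('x \<times> (real ^ ('y \<times> 'm))) measure \<Rightarrow> real" where
  "What PX l V \<phi> = V (Qhat PX l \<phi>)"

definition W_inf ::
  "('z::finite \<Rightarrow> 'y::finite pmf) \<Rightarrow> ('x::finite \<Rightarrow> 'x \<Rightarrow> real) \<Rightarrow> real
    \<Rightarrow> (('x \<times> (real ^ ('y \<times> 'm::finite))) measure \<Rightarrow> real)
    \<Rightarrow> ('x \<times> (real ^ 'm)) measure \<Rightarrow> real" where
  "W_inf chan \<rho> \<beta> Vh \<pi> = (INF c\<in>enc_rules. W chan \<rho> \<beta> c Vh \<pi>)"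

definition What_inf ::
  "('x::finite \<Rightarrow> 'x pmf)
    \<Rightarrow> (('x \<times> (real ^ 'm::finite)) measure \<Rightarrow> real)
    \<Rightarrow> ('x \<times> (real ^ ('y::finite \<times> 'm))) measure \<Rightarrow> real" where
  "What_inf PX V \<phi> = (INF l\<in>UNIV. What PX l V \<phi>)"

section \<open>Value functions\<close>

text \<open>\<open>pi_path PX chan c l t \<pi> k\<close> is the state \<open>\<pi>\<^sub>t\<^sub>+\<^sub>k\<close> reached from \<open>\<pi>\<^sub>t = \<pi>\<close>;
  \<open>phi_path PX chan c l t \<phi> k\<close> is the state \<open>\<phi>\<^sub>t\<^sub>+\<^sub>k\<close> reached from \<open>\<phi>\<^sub>t = \<phi>\<close>.\<close>

primrec pi_path ::
  "('x::finite \<Rightarrow> 'x pmf) \<Rightarrow> ('z::finite \<Rightarrow> 'y::finite pmf)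
    \<Rightarrow> (nat \<Rightarrow> 'x \<times> (real ^ 'm::finite) \<Rightarrow> 'z) \<Rightarrow> (nat \<Rightarrow> 'y \<times> 'm \<Rightarrow> 'm)
    \<Rightarrow> nat \<Rightarrow> ('x \<times> (real ^ 'm)) measure \<Rightarrow> nat \<Rightarrow> ('x \<times> (real ^ 'm)) measure" where
  "pi_path PX chan c l t \<pi> 0 = \<pi>"
| "pi_path PX chan c l t \<pi> (Suc k) =
     Qhat PX (l (t + k)) (Q chan (c (t + k)) (pi_path PX chan c l t \<pi> k))"

primrec phi_path ::
  "('x::finite \<Rightarrow> 'x pmf) \<Rightarrow> ('z::finite \<Rightarrow> 'y::finite pmf)
    \<Rightarrow> (nat \<Rightarrow> 'x \<times> (real ^ 'm::finite) \<Rightarrow> 'z) \<Rightarrow> (nat \<Rightarrow> 'y \<times> 'm \<Rightarrow> 'm)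
    \<Rightarrow> nat \<Rightarrow> ('x \<times> (real ^ ('y \<times> 'm))) measure \<Rightarrow> nat \<Rightarrow> ('x \<times> (real ^ ('y \<times> 'm))) measure" where
  "phi_path PX chan c l t \<phi> 0 = \<phi>"
| "phi_path PX chan c l t \<phi> (Suc k) =
     Q chan (c (Suc (t + k))) (Qhat PX (l (t + k)) (phi_path PX chan c l t \<phi> k))"

text \<open>The series converge for \<open>0 < \<beta> < 1\<close>: \<open>rho_tilde \<rho>\<close> is at most \<open>max \<rho>\<close> on information
  states.  In the value functions, rules for times before the initial one are irrelevant and
  hence left unconstrained.\<close>

definition cost_pi ::
  "('x::finite \<Rightarrow> 'x pmf) \<Rightarrow> ('z::finite \<Rightarrow> 'y::finite pmf) \<Rightarrow> ('x \<Rightarrow> 'x \<Rightarrow> real) \<Rightarrow> real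
    \<Rightarrow> (nat \<Rightarrow> 'x \<times> (real ^ 'm::finite) \<Rightarrow> 'z) \<Rightarrow> (nat \<Rightarrow> 'y \<times> 'm \<Rightarrow> 'm)
    \<Rightarrow> nat \<Rightarrow> ('x \<times> (real ^ 'm)) measure \<Rightarrow> real" where
  "cost_pi PX chan \<rho> \<beta> c l t \<pi> =
     (\<Sum>k. \<beta> ^ k * rho_tilde \<rho> (Q chan (c (t + k)) (pi_path PX chan c l t \<pi> k)))"

definition cost_phi ::
  "('x::finite \<Rightarrow> 'x pmf) \<Rightarrow> ('z::finite \<Rightarrow> 'y::finite pmf) \<Rightarrow> ('x \<Rightarrow> 'x \<Rightarrow> real) \<Rightarrow> real
    \<Rightarrow> (nat \<Rightarrow> 'x \<times> (real ^ 'm::finite) \<Rightarrow> 'z) \<Rightarrow> (nat \<Rightarrow> 'y \<times> 'm \<Rightarrow> 'm)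
    \<Rightarrow> nat \<Rightarrow> ('x \<times> (real ^ ('y \<times> 'm))) measure \<Rightarrow> real" where
  "cost_phi PX chan \<rho> \<beta> c l t \<phi> =
     (\<Sum>k. \<beta> ^ k * rho_tilde \<rho> (phi_path PX chan c l t \<phi> (Suc k)))"

definition V ::
  "('x::finite \<Rightarrow> 'x pmf) \<Rightarrow> ('z::finite \<Rightarrow> 'y::finite pmf) \<Rightarrow> ('x \<Rightarrow> 'x \<Rightarrow> real) \<Rightarrow> real
    \<Rightarrow> nat \<Rightarrow> ('x \<times> (real ^ 'm::finite)) measure \<Rightarrow> real" where
  "V PX chan \<rho> \<beta> t \<pi> =
     (INF (c, l)\<in>({t..} \<rightarrow> enc_rules) \<times> UNIV. cost_pi PX chan \<rho> \<beta> c l t \<pi>)"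

definition Vhat ::
  "('x::finite \<Rightarrow> 'x pmf) \<Rightarrow> ('z::finite \<Rightarrow> 'y::finite pmf) \<Rightarrow> ('x \<Rightarrow> 'x \<Rightarrow> real) \<Rightarrow> real
    \<Rightarrow> nat \<Rightarrow> ('x \<times> (real ^ ('y \<times> 'm::finite))) measure \<Rightarrow> real" where
  "Vhat PX chan \<rho> \<beta> t \<phi> =
     (INF (c, l)\<in>({Suc t..} \<rightarrow> enc_rules) \<times> UNIV. cost_phi PX chan \<rho> \<beta> c l t \<phi>)"

section \<open>The stochastic system\<close>

text \<open>Processes live on an arbitrary probability space \<open>\<Omega>\<close>; \<open>memory m0 l Y t\<close> is \<open>M\<^sub>t\<close>.\<close>

primrec memory ::
  "'m \<Rightarrow> (nat \<Rightarrow> 'y \<times> 'm \<Rightarrow> 'm) \<Rightarrow> (nat \<Rightarrow> 'o \<Rightarrow> 'y) \<Rightarrow> nat \<Rightarrow> 'o \<Rightarrow> 'm" where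
  "memory m0 l Y 0 \<omega> = m0"
| "memory m0 l Y (Suc t) \<omega> = l (Suc t) (Y (Suc t) \<omega>, memory m0 l Y t \<omega>)"

text \<open>The encoder's belief: the conditional law of \<open>M\<^sub>t\<close> given the observed histories of \<open>X\<close> and
  \<open>Z\<close> up to time \<open>t\<close>.  On the null set where the conditioning event has probability 0 the value
  is the zero vector, which plays no role.\<close>

definition belief ::
  "'o measure \<Rightarrow> (nat \<Rightarrow> 'o \<Rightarrow> 'x) \<Rightarrow> (nat \<Rightarrow> 'o \<Rightarrow> 'z) \<Rightarrow> (nat \<Rightarrow> 'o \<Rightarrow> 'm::finite)
    \<Rightarrow> nat \<Rightarrow> 'o \<Rightarrow> (real ^ 'm)" where
  "belief \<Omega> X Z Mem t \<omega> =
     (\<chi> m. \<P>(\<omega>' in \<Omega>. Mem t \<omega>' = m \<bar> \<forall>s\<in>{1..t}. X s \<omega>' = X s \<omega> \<and> Z s \<omega>' = Z s \<omega>))"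

text \<open>\<open>X, Z, Y\<close> are the source, channel input and channel output processes of the system run with
  the rules \<open>c, l\<close>.  The law of \<open>X\<^sub>t\<^sub>+\<^sub>1\<close> is prescribed conditionally on the whole past
  of source and channel: this comprises both the Markov property and the independence of the
  source from the channel noise.\<close>

definition is_realization ::
  "'x::finite pmf \<Rightarrow> ('x \<Rightarrow> 'x pmf) \<Rightarrow> ('z::finite \<Rightarrow> 'y::finite pmf) \<Rightarrow> 'm::finite
    \<Rightarrow> (nat \<Rightarrow> 'x \<times> (real ^ 'm) \<Rightarrow> 'z) \<Rightarrow> (nat \<Rightarrow> 'y \<times> 'm \<Rightarrow> 'm)
    \<Rightarrow> 'o measure \<Rightarrow> (nat \<Rightarrow> 'o \<Rightarrow> 'x) \<Rightarrow> (nat \<Rightarrow> 'o \<Rightarrow> 'z) \<Rightarrow> (nat \<Rightarrow> 'o \<Rightarrow> 'y) \<Rightarrow> bool" where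
  "is_realization muX PX chan m0 c l \<Omega> X Z Y \<longleftrightarrow>
     prob_space \<Omega> \<and>
     (\<forall>t\<ge>1. X t \<in> \<Omega> \<rightarrow>\<^sub>M count_space UNIV \<and> Z t \<in> \<Omega> \<rightarrow>\<^sub>M count_space UNIV \<and>
            Y t \<in> \<Omega> \<rightarrow>\<^sub>M count_space UNIV) \<and>
     distr \<Omega> (count_space UNIV) (X 1) = measure_pmf muX \<and>
     (\<forall>t\<ge>1. \<forall>xs zs ys x'.
        \<P>(\<omega> in \<Omega>. \<forall>s\<in>{1..t}. X s \<omega> = xs s \<and> Z s \<omega> = zs s \<and> Y s \<omega> = ys s) > 0 \<longrightarrow>
        \<P>(\<omega> in \<Omega>. X (Suc t) \<omega> = x' \<bar> \<forall>s\<in>{1..t}. X s \<omega> = xs s \<and> Z s \<omega> = zs s \<and> Y s \<omega> = ys s)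
          = pmf (PX (xs t)) x') \<and>
     (\<forall>t\<ge>1. \<forall>xs zs ys y.
        \<P>(\<omega> in \<Omega>. (\<forall>s\<in>{1..t}. X s \<omega> = xs s \<and> Z s \<omega> = zs s) \<and> (\<forall>s\<in>{1..<t}. Y s \<omega> = ys s)) > 0 \<longrightarrow>
        \<P>(\<omega> in \<Omega>. Y t \<omega> = y \<bar> (\<forall>s\<in>{1..t}. X s \<omega> = xs s \<and> Z s \<omega> = zs s) \<and> (\<forall>s\<in>{1..<t}. Y s \<omega> = ys s))
          = pmf (chan (zs t)) y) \<and>
     (\<forall>t\<ge>1. AE \<omega> in \<Omega>. Z t \<omega> = c t (X t \<omega>, belief \<Omega> X Z (memory m0 l Y) (t - 1) \<omega>))"

definition is_optimal_decoder ::
  "('x::finite \<Rightarrow> 'x \<Rightarrow> real) \<Rightarrow> 'm::finite \<Rightarrow> (nat \<Rightarrow> 'y::finite \<times> 'm \<Rightarrow> 'm)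
    \<Rightarrow> 'o measure \<Rightarrow> (nat \<Rightarrow> 'o \<Rightarrow> 'x) \<Rightarrow> (nat \<Rightarrow> 'o \<Rightarrow> 'y) \<Rightarrow> (nat \<Rightarrow> 'y \<times> 'm \<Rightarrow> 'x) \<Rightarrow> bool" where
  "is_optimal_decoder \<rho> m0 l \<Omega> X Y g \<longleftrightarrow>
     (\<forall>t\<ge>1. \<forall>y m. \<P>(\<omega> in \<Omega>. Y t \<omega> = y \<and> memory m0 l Y (t - 1) \<omega> = m) > 0 \<longrightarrow>
        is_arg_min
          (\<lambda>xh. \<Sum>x\<in>UNIV. \<rho> x xh * \<P>(\<omega> in \<Omega>. X t \<omega> = x \<bar> Y t \<omega> = y \<and> memory m0 l Y (t - 1) \<omega> = m))
          (\<lambda>xh. True) (g t (y, m)))"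

text \<open>The criterion \<open>J\<close>; the encoding rules enter through the law of the processes.  The sum over
  \<open>t \<ge> 1\<close> is written with \<open>t = k + 1\<close>.\<close>

definition J ::
  "('x \<Rightarrow> 'x \<Rightarrow> real) \<Rightarrow> real \<Rightarrow> 'm \<Rightarrow> (nat \<Rightarrow> 'y \<times> 'm \<Rightarrow> 'x) \<Rightarrow> (nat \<Rightarrow> 'y \<times> 'm \<Rightarrow> 'm)
    \<Rightarrow> 'o measure \<Rightarrow> (nat \<Rightarrow> 'o \<Rightarrow> 'x) \<Rightarrow> (nat \<Rightarrow> 'o \<Rightarrow> 'y) \<Rightarrow> real" where
  "J \<rho> \<beta> m0 g l \<Omega> X Y =
     (\<integral>\<omega>. (\<Sum>k. \<beta> ^ k * \<rho> (X (Suc k) \<omega>) (g (Suc k) (Y (Suc k) \<omega>, memory m0 l Y k \<omega>))) \<partial>\<Omega>)"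

end

theory Submission
  imports Defs
begin

text \<open>
  The discounted cost of a pair of rule sequences splits as first-stage cost plus \<open>\<beta>\<close> times the
  cost of the shifted sequences; taking infima separately over the first rule and over the rest
  gives the two equations, and iterating them along a trajectory of minimizers shows that all its
  partial costs are at most \<open>V\<^sub>1(\<pi>\<^sub>1)\<close>.

  For the criterion \<open>J\<close>, the state \<open>\<pi>\<^sub>t\<close> is identified with the law of
  \<open>(X\<^sub>t, P\<^sub>M\<^sub>t\<^sub>-\<^sub>1)\<close>.  The encoder history \<open>(X\<^sup>t, Z\<^sup>t)\<close> takes finitely many values, so
  conditioning is done fibre by fibre: given this history, \<open>(Y\<^sub>t, M\<^sub>t\<^sub>-\<^sub>1)\<close> has law
  \<open>\<nu>(P\<^sub>M\<^sub>t\<^sub>-\<^sub>1, Z\<^sub>t)\<close>, hence the belief is updated by \<open>\<psi>\<close> and an optimal decoder pays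
  \<open>rho_tilde\<close> of the state \<open>\<phi>\<^sub>t\<close>.
\<close>

section \<open>Information states\<close>

text \<open>The infima are taken in the reals, so they behave well only over nonempty sets that are
  bounded below; this is why the equations are proved on \<open>info_states\<close> and why closure
  of these sets under \<open>Q\<close> and \<open>Qhat\<close> is established beforehand. The
  equations do not presuppose minimizers, and no approximate minimizers are chosen: each inequality
  is tested against arbitrary rule sequences. The prescribed laws condition on source, input and
  output histories, whereas the belief conditions on the first two only. The transition
  probabilities do not depend on past outputs, so they survive summation over output histories, and
  these histories determine the memory. The laws of the states are compared through integrals of
  nonnegative functions, not as image measures: on a null encoder history the belief is the zero
  vector, which lies outside the simplex, so the pair of source symbol and belief need not map into
  \<open>belief_space\<close>.\<close>

lemma borel_measurable_vecI:
  fixes f :: "'a \<Rightarrow> real ^ 'n::finite"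
  assumes "\<And>i. (\<lambda>x. f x $ i) \<in> borel_measurable M"
  shows "f \<in> borel_measurable M"
  using assms
  by (intro borel_measurable_euclidean_space[THEN iffD2]) (auto simp: Basis_vec_def inner_axis)

lemma space_belief_space:
  "space (belief_space :: ('x::finite \<times> (real ^ 'n::finite)) measure) = UNIV \<times> prob_simplex"
  by (simp add: belief_space_def space_pair_measure space_restrict_space)

lemma measurable_belief_space_fst [measurable]:
  "fst \<in> (belief_space :: ('x::finite \<times> (real ^ 'n::finite)) measure) \<rightarrow>\<^sub>M count_space UNIV"
  unfolding belief_space_def by measurable

lemma measurable_belief_space_nth [measurable]:
  "(\<lambda>xp. snd xp $ i) \<in> borel_measurable (belief_space :: ('x::finite \<times> (real ^ 'n::finite)) measure)"
proof -
  have "(\<lambda>p :: real ^ 'n. p $ i) \<in> borel_measurable (restrict_space borel prob_simplex)"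
    by (intro measurable_restrict_space1 borel_measurable_nth)
  then show ?thesis
    unfolding belief_space_def by (rule measurable_compose[OF measurable_snd])
qed

lemma measurable_belief_spaceI:
  fixes f :: "'a \<Rightarrow> 'x::finite" and g :: "'a \<Rightarrow> real ^ 'n::finite"
  assumes "f \<in> M \<rightarrow>\<^sub>M count_space UNIV"
    and "\<And>i. (\<lambda>a. g a $ i) \<in> borel_measurable M"
    and "\<And>a. a \<in> space M \<Longrightarrow> g a \<in> prob_simplex"
  shows "(\<lambda>a. (f a, g a)) \<in> M \<rightarrow>\<^sub>M belief_space"
  unfolding belief_space_def
  using assms by (intro measurable_Pair measurable_restrict_space2 borel_measurable_vecI) auto

lemma simplex_bounds:
  assumes "p \<in> prob_simplex" shows "0 \<le> p $ i" and "p $ i \<le> 1"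
  using assms member_le_sum[of i UNIV "\<lambda>i. p $ i"] by (auto simp: prob_simplex_def)

lemma nu_in_simplex:
  assumes "p \<in> prob_simplex" shows "nu chan p z \<in> prob_simplex"
proof -
  have "(\<Sum>ym\<in>UNIV. pmf (chan z) (fst ym) * p $ snd ym)
      = (\<Sum>y\<in>UNIV. \<Sum>m\<in>UNIV. pmf (chan z) y * p $ m)"
    by (simp add: sum.cartesian_product case_prod_beta)
  also have "\<dots> = (\<Sum>y\<in>UNIV. pmf (chan z) y) * (\<Sum>m\<in>UNIV. p $ m)"
    by (simp add: sum_product)
  also have "\<dots> = 1"
    using assms by (simp add: prob_simplex_def sum_pmf_eq_1)
  finally show ?thesis
    using assms by (auto simp: prob_simplex_def nu_def)
qed

lemma psi_in_simplex:
  fixes q :: "real ^ ('y::finite \<times> 'm::finite)"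
  assumes "q \<in> prob_simplex" shows "psi q l \<in> prob_simplex"
proof -
  have "(\<Sum>m\<in>UNIV. \<Sum>ym | l ym = m. q $ ym) = (\<Sum>ym\<in>UNIV. q $ ym)"
    using sum.group[of "UNIV :: ('y \<times> 'm) set" "UNIV :: 'm set" l "\<lambda>ym. q $ ym"] by simp
  then show ?thesis
    using assms by (auto simp: prob_simplex_def psi_def intro!: sum_nonneg)
qed

lemma axis_in_simplex: "axis m 1 \<in> prob_simplex"
  by (auto simp: prob_simplex_def axis_def)

section \<open>The maps \<open>Q\<close> and \<open>Qhat\<close> on information states\<close>

lemma Q_measurable:
  assumes c: "c \<in> enc_rules"
  shows "(\<lambda>(x, p). (x, nu chan p (c (x, p)))) \<in> belief_space \<rightarrow>\<^sub>M belief_space"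
proof -
  have [measurable]: "c \<in> belief_space \<rightarrow>\<^sub>M count_space UNIV"
    using c by (simp add: enc_rules_def)
  show ?thesis
    unfolding case_prod_beta
  proof (rule measurable_belief_spaceI)
    show "(\<lambda>a. nu chan (snd a) (c (fst a, snd a)) $ i) \<in> borel_measurable belief_space" for i
      by (simp add: nu_def)
  qed (auto simp: space_belief_space intro: nu_in_simplex)
qed

lemma info_states_iff:
  "\<pi> \<in> info_states \<longleftrightarrow> sets \<pi> = sets belief_space \<and> prob_space \<pi>"
  by (simp add: info_states_def space_prob_algebra)

lemma info_states_measurable_iff:
  assumes "\<pi> \<in> info_states"
  shows "f \<in> \<pi> \<rightarrow>\<^sub>M N \<longleftrightarrow> f \<in> belief_space \<rightarrow>\<^sub>M N"
proof -
  have "sets \<pi> = sets belief_space"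
    using assms unfolding info_states_iff by blast
  from measurable_cong_sets[OF this refl, of N] show ?thesis by simp
qed

lemma info_states_simplex:
  assumes "\<phi> \<in> info_states" "a \<in> space \<phi>"
  shows "snd a \<in> prob_simplex"
proof -
  have "space \<phi> = UNIV \<times> prob_simplex"
    using assms(1) sets_eq_imp_space_eq[of \<phi> belief_space]
    by (simp add: info_states_iff space_belief_space)
  with assms(2) show ?thesis by (metis mem_Times_iff)
qed

lemma Q_info_states:
  assumes "c \<in> enc_rules" "\<pi> \<in> info_states"
  shows "Q chan c \<pi> \<in> info_states"
proof -
  have "(\<lambda>(x, p). (x, nu chan p (c (x, p)))) \<in> \<pi> \<rightarrow>\<^sub>M belief_space"
    using Q_measurable[OF assms(1)] info_states_measurable_iff[OF assms(2)] by blast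
  moreover have "prob_space \<pi>"
    using assms(2) unfolding info_states_iff by blast
  ultimately show ?thesis
    unfolding info_states_iff Q_def by (simp add: prob_space.prob_space_distr)
qed

lemma nn_integral_Q:
  assumes "c \<in> enc_rules" "\<pi> \<in> info_states" "h \<in> borel_measurable belief_space"
  shows "(\<integral>\<^sup>+a. h a \<partial>Q chan c \<pi>) = (\<integral>\<^sup>+a. h (fst a, nu chan (snd a) (c a)) \<partial>\<pi>)"
proof -
  have "(\<lambda>(x, p). (x, nu chan p (c (x, p)))) \<in> \<pi> \<rightarrow>\<^sub>M belief_space"
    using Q_measurable[OF assms(1)] info_states_measurable_iff[OF assms(2)] by blast
  then show ?thesis
    using assms(3) unfolding Q_def by (subst nn_integral_distr) (simp_all add: case_prod_beta)
qed

text \<open>Measurability into \<open>prob_algebra\<close> is what makes the \<open>bind\<close> in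
  \<open>Qhat\<close> a probability measure on \<open>belief_space\<close> and gives the iterated
  integral in \<open>nn_integral_Qhat\<close>.\<close>

lemma Qhat_kernel:
  "(\<lambda>(x, q). distr (measure_pmf (PX x)) belief_space (\<lambda>x'. (x', psi q l)))
     \<in> belief_space \<rightarrow>\<^sub>M prob_algebra belief_space"
proof -
  have *: "(\<lambda>a. measure_pmf (PX (fst a))) \<in> belief_space \<rightarrow>\<^sub>M prob_algebra (count_space UNIV)"
    by (rule measurable_compose[OF measurable_belief_space_fst])
       (simp add: space_prob_algebra measure_pmf.prob_space_axioms)
  show ?thesis
    unfolding case_prod_beta
  proof (rule measurable_distr_prob_space2[OF *], unfold case_prod_beta, rule measurable_belief_spaceI)
    show "(\<lambda>a. psi (snd (fst a)) l $ i)
        \<in> borel_measurable (belief_space \<Otimes>\<^sub>M count_space UNIV)" for i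
      by (simp add: psi_def)
  qed (auto simp: space_pair_measure space_belief_space intro: psi_in_simplex)
qed

lemma Qhat_info_states:
  assumes "\<phi> \<in> info_states" shows "Qhat PX l \<phi> \<in> info_states"
proof -
  note \<phi> = assms[unfolded info_states_def]
  show ?thesis
    unfolding info_states_iff Qhat_def
    using prob_space_bind'[OF \<phi> Qhat_kernel] sets_bind'[OF \<phi> Qhat_kernel] by (rule conjI[rotated])
qed

lemma nn_integral_Qhat:
  assumes "\<phi> \<in> info_states" and h: "h \<in> borel_measurable belief_space"
  shows "(\<integral>\<^sup>+a. h a \<partial>Qhat PX l \<phi>)
    = (\<integral>\<^sup>+a. (\<Sum>x'\<in>UNIV. ennreal (pmf (PX (fst a)) x') * h (x', psi (snd a) l)) \<partial>\<phi>)"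
proof -
  have "(\<integral>\<^sup>+a. h a \<partial>Qhat PX l \<phi>)
     = (\<integral>\<^sup>+a. \<integral>\<^sup>+b. h b \<partial>distr (measure_pmf (PX (fst a))) belief_space (\<lambda>x'. (x', psi (snd a) l)) \<partial>\<phi>)"
    unfolding Qhat_def using measurable_prob_algebraD[OF Qhat_kernel[of PX l]]
    by (subst nn_integral_bind[OF h])
       (simp_all add: case_prod_beta info_states_measurable_iff[OF assms(1)])
  also have "\<dots> = (\<integral>\<^sup>+a. (\<Sum>x'\<in>UNIV. ennreal (pmf (PX (fst a)) x') * h (x', psi (snd a) l)) \<partial>\<phi>)"
  proof (rule nn_integral_cong)
    fix a assume "a \<in> space \<phi>"
    then have "snd a \<in> prob_simplex"
      by (rule info_states_simplex[OF assms(1)])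
    then have "(\<lambda>x'. (x', psi (snd a) l)) \<in> measure_pmf (PX (fst a)) \<rightarrow>\<^sub>M belief_space"
      by (intro measurable_belief_spaceI) (auto intro: psi_in_simplex)
    from nn_integral_distr[OF this, of h] h
    have *: "(\<integral>\<^sup>+b. h b \<partial>distr (measure_pmf (PX (fst a))) belief_space (\<lambda>x'. (x', psi (snd a) l)))
       = (\<integral>\<^sup>+x'. h (x', psi (snd a) l) \<partial>measure_pmf (PX (fst a)))" by simp
    show "(\<integral>\<^sup>+b. h b \<partial>distr (measure_pmf (PX (fst a))) belief_space (\<lambda>x'. (x', psi (snd a) l)))
       = (\<Sum>x'\<in>UNIV. ennreal (pmf (PX (fst a)) x') * h (x', psi (snd a) l))"
      unfolding * nn_integral_measure_pmf by (rule nn_integral_count_space_finite) simp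
  qed
  finally show ?thesis .
qed

lemma init_state_measurable:
  "(\<lambda>x. (x, axis m0 1)) \<in> measure_pmf muX \<rightarrow>\<^sub>M belief_space"
  by (intro measurable_belief_spaceI) (auto intro: axis_in_simplex)

lemma init_state_info_states: "init_state muX m0 \<in> info_states"
  unfolding info_states_iff init_state_def
  using measure_pmf.prob_space_distr[OF init_state_measurable] by simp

text \<open>Since the entries of \<open>q\<close> lie between 0 and 1, each of the
  \<open>CARD('y \<times> 'm)\<close> minima lies between 0 and \<open>B\<close>. The factor is
  crude, as the entries sum to 1 and \<open>B\<close> alone would do, but any uniform bound gives
  summability.\<close>

lemma rho_tilde_bounds:
  fixes \<phi> :: "('x::finite \<times> (real ^ ('y::finite \<times> 'm::finite))) measure"
  assumes "\<And>x xh. 0 \<le> \<rho> x xh" and "\<And>x xh. \<rho> x xh \<le> B" and "\<phi> \<in> info_states"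
  shows "0 \<le> rho_tilde \<rho> \<phi>" and "rho_tilde \<rho> \<phi> \<le> real CARD('y \<times> 'm) * B"
proof -
  have "prob_space \<phi>"
    using assms(3) unfolding info_states_iff by blast
  then interpret prob_space \<phi> .
  have q: "0 \<le> snd a $ i" "snd a $ i \<le> 1" if "a \<in> space \<phi>" for a i
    using simplex_bounds[OF info_states_simplex[OF assms(3) that]] by blast+
  have B: "0 \<le> B" using assms(1,2)[of undefined undefined] by linarith
  define I where "I ym xh = (\<integral>(x, q). \<rho> x xh * q $ ym \<partial>\<phi>)" for ym :: "'y \<times> 'm" and xh
  have b: "0 \<le> \<rho> (fst a) xh * snd a $ ym \<and> \<rho> (fst a) xh * snd a $ ym \<le> B"
    if "a \<in> space \<phi>" for a xh ym
    using mult_mono[of "\<rho> (fst a) xh" B "snd a $ ym" 1] q[OF that, of ym] assms(1,2) B by simp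
  have I0: "0 \<le> I ym xh" for ym xh
    unfolding I_def case_prod_beta using b by (intro Bochner_Integration.integral_nonneg) blast
  have [measurable_cong]: "sets \<phi> = sets belief_space"
    using assms(3) by (simp add: info_states_iff)
  have IB: "I ym xh \<le> B" for ym xh
    unfolding I_def case_prod_beta
  proof (rule integral_le_const)
    show "AE a in \<phi>. \<rho> (fst a) xh * snd a $ ym \<le> B"
      using b by (intro AE_I2) blast
    show "integrable \<phi> (\<lambda>a. \<rho> (fst a) xh * snd a $ ym)"
    proof (rule integrable_const_bound[where B=B])
      show "AE a in \<phi>. norm (\<rho> (fst a) xh * snd a $ ym) \<le> B"
        using b by (intro AE_I2) (metis abs_of_nonneg real_norm_def)
    qed measurable
  qed
  have "rho_tilde \<rho> \<phi> = (\<Sum>ym\<in>UNIV. Min (range (I ym)))"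
    by (simp add: rho_tilde_def I_def)
  moreover have "0 \<le> Min (range (I ym))" for ym
    using I0 by simp
  moreover have "Min (range (I ym)) \<le> B" for ym
    using IB[of ym undefined] by (meson Min_le finite finite_imageI order_trans rangeI)
  ultimately show "0 \<le> rho_tilde \<rho> \<phi>" "rho_tilde \<rho> \<phi> \<le> real CARD('y \<times> 'm) * B"
    using sum_bounded_above[of "UNIV :: ('y \<times> 'm) set" "\<lambda>ym. Min (range (I ym))" B]
    by (auto intro: sum_nonneg)
qed

section \<open>Dynamic programming\<close>

text \<open>Both paths run through the same alternating word of \<open>Q\<close> and
  \<open>Qhat\<close>, bracketed differently. This lemma and \<open>phi_path_Suc_eq\<close> change
  the bracketing, so that a cost series can be read from either kind of state.\<close>

lemma Q_pi_path:
  "Q chan (c (t + k)) (pi_path PX chan c l t \<pi> k) = phi_path PX chan c l t (Q chan (c t) \<pi>) k"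
  by (induction k) simp_all

lemma phi_path_Suc_eq:
  "phi_path PX chan c l t \<phi> (Suc k)
    = Q chan (c (Suc t + k)) (pi_path PX chan c l (Suc t) (Qhat PX (l t) \<phi>) k)"
  by (induction k) simp_all

lemma pi_path_info_states:
  assumes "c \<in> {t..} \<rightarrow> enc_rules" "\<pi> \<in> info_states"
  shows "pi_path PX chan c l t \<pi> k \<in> info_states"
  using assms by (induction k) (auto intro!: Qhat_info_states Q_info_states)

lemma pi_path_cong:
  assumes "\<And>s. t \<le> s \<Longrightarrow> c s = c' s" "\<And>s. t \<le> s \<Longrightarrow> l s = l' s"
  shows "pi_path PX chan c l t \<pi> k = pi_path PX chan c' l' t \<pi> k"
  by (induction k) (simp_all add: assms)

text \<open>Allows the rule at time \<open>t\<close> to be overwritten while the cost from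
  \<open>Suc t\<close> on stays the same: this decouples the first rule from the later ones in the
  two equations.\<close>

lemma cost_pi_cong:
  assumes "\<And>s. t \<le> s \<Longrightarrow> c s = c' s" "\<And>s. t \<le> s \<Longrightarrow> l s = l' s"
  shows "cost_pi PX chan \<rho> \<beta> c l t \<pi> = cost_pi PX chan \<rho> \<beta> c' l' t \<pi>"
proof -
  have "pi_path PX chan c l t \<pi> k = pi_path PX chan c' l' t \<pi> k" for k
    using assms by (rule pi_path_cong)
  then show ?thesis by (simp add: cost_pi_def assms(1))
qed

lemma cost_phi_eq_cost_pi:
  "cost_phi PX chan \<rho> \<beta> c l t \<phi> = cost_pi PX chan \<rho> \<beta> c l (Suc t) (Qhat PX (l t) \<phi>)"
  unfolding cost_phi_def cost_pi_def phi_path_Suc_eq ..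

locale discounted_cost =
  fixes PX :: "'x::finite \<Rightarrow> 'x pmf" and chan :: "'z::finite \<Rightarrow> 'y::finite pmf"
    and \<rho> :: "'x \<Rightarrow> 'x \<Rightarrow> real" and \<beta> :: real
  assumes rho_nonneg: "0 \<le> \<rho> x xh" and beta_pos: "0 < \<beta>" and beta_less_1: "\<beta> < 1"
begin

lemma rho_bounded:
  obtains B where "0 \<le> B" "\<And>x xh. \<rho> x xh \<le> B"
proof -
  \<comment> \<open>Since the distortions are nonnegative, their total over the finite alphabet
    bounds each of them.\<close>
  have "\<rho> x xh \<le> (\<Sum>x\<in>UNIV. \<Sum>xh\<in>UNIV. \<rho> x xh)" for x xh
  proof -
    have "\<rho> x xh \<le> (\<Sum>xh\<in>UNIV. \<rho> x xh)"
      by (rule member_le_sum) (auto simp: rho_nonneg)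
    also have "\<dots> \<le> (\<Sum>x\<in>UNIV. \<Sum>xh\<in>UNIV. \<rho> x xh)"
      by (rule member_le_sum) (auto simp: rho_nonneg sum_nonneg)
    finally show ?thesis .
  qed
  moreover have "0 \<le> (\<Sum>x\<in>UNIV. \<Sum>xh\<in>UNIV. \<rho> x xh)"
    by (simp add: rho_nonneg sum_nonneg)
  ultimately show ?thesis using that by blast
qed

lemma rho_tilde_nonneg:
  fixes \<phi> :: "('x \<times> (real ^ ('b::finite \<times> 'm::finite))) measure"
  assumes "\<phi> \<in> info_states" shows "0 \<le> rho_tilde \<rho> \<phi>"
proof -
  obtain B where "\<And>x xh. \<rho> x xh \<le> B" using rho_bounded by blast
  from rho_tilde_bounds(1)[OF rho_nonneg this assms] show ?thesis .
qed

lemma discounted_summable: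
  fixes \<phi> :: "nat \<Rightarrow> ('x \<times> (real ^ ('b::finite \<times> 'm::finite))) measure"
  assumes "\<And>k. \<phi> k \<in> info_states"
  shows "summable (\<lambda>k. \<beta> ^ k * rho_tilde \<rho> (\<phi> k))"
proof -
  obtain B where B: "0 \<le> B" "\<And>x xh. \<rho> x xh \<le> B" using rho_bounded by blast
  have "summable (\<lambda>k. \<beta> ^ k * (real CARD('b \<times> 'm) * B))"
    using beta_pos beta_less_1 by (intro summable_mult2 summable_geometric) simp
  then show ?thesis
  proof (rule summable_comparison_test')
    show "norm (\<beta> ^ k * rho_tilde \<rho> (\<phi> k)) \<le> \<beta> ^ k * (real CARD('b \<times> 'm) * B)" if "0 \<le> k" for k
      using rho_tilde_bounds[OF rho_nonneg B(2) assms] beta_pos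
      by (simp add: abs_mult mult_left_mono)
  qed
qed

lemma Q_path_info_states:
  assumes "c \<in> {t..} \<rightarrow> enc_rules" "\<pi> \<in> info_states"
  shows "Q chan (c (t + k)) (pi_path PX chan c l t \<pi> k) \<in> info_states"
  using assms by (intro Q_info_states pi_path_info_states) auto

lemma cost_pi_rec:
  assumes "c \<in> {t..} \<rightarrow> enc_rules" "\<pi> \<in> info_states"
  shows "cost_pi PX chan \<rho> \<beta> c l t \<pi>
    = rho_tilde \<rho> (Q chan (c t) \<pi>) + \<beta> * cost_phi PX chan \<rho> \<beta> c l t (Q chan (c t) \<pi>)"
proof -
  define r where "r k = rho_tilde \<rho> (phi_path PX chan c l t (Q chan (c t) \<pi>) k)" for k
  have s: "summable (\<lambda>k. \<beta> ^ k * r k)"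
    unfolding r_def
    by (rule discounted_summable) (simp flip: Q_pi_path add: Q_path_info_states[OF assms])
  \<comment> \<open>Rescaling by \<open>inverse \<beta>\<close> turns the powers
    \<open>\<beta> ^ Suc k\<close> of the tail into \<open>\<beta> ^ k\<close>, the form in which
    \<open>suminf_mult\<close> needs summability.\<close>
  have s': "summable (\<lambda>k. \<beta> ^ k * r (Suc k))"
    using summable_mult[OF summable_Suc_iff[THEN iffD2, OF s], of "inverse \<beta>"] beta_pos
    by (simp add: mult.assoc[symmetric])
  have "(\<Sum>k. \<beta> ^ k * r k) = r 0 + (\<Sum>k. \<beta> * (\<beta> ^ k * r (Suc k)))"
    using suminf_split_head[OF s] by (simp add: mult.assoc)
  also have "(\<Sum>k. \<beta> * (\<beta> ^ k * r (Suc k))) = \<beta> * (\<Sum>k. \<beta> ^ k * r (Suc k))"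
    by (rule suminf_mult[OF s'])
  finally show ?thesis
    by (simp add: cost_pi_def cost_phi_def Q_pi_path r_def)
qed

lemma cost_pi_nonneg:
  assumes "c \<in> {t..} \<rightarrow> enc_rules" "\<pi> \<in> info_states"
  shows "0 \<le> cost_pi PX chan \<rho> \<beta> c l t \<pi>"
  unfolding cost_pi_def
  using Q_path_info_states[OF assms] beta_pos
  by (intro suminf_nonneg discounted_summable) (auto simp: rho_tilde_nonneg)

lemma cost_phi_nonneg:
  assumes "c \<in> {Suc t..} \<rightarrow> enc_rules" "\<phi> \<in> info_states"
  shows "0 \<le> cost_phi PX chan \<rho> \<beta> c l t \<phi>"
  unfolding cost_phi_eq_cost_pi by (intro cost_pi_nonneg assms Qhat_info_states)

text \<open>A constant rule is measurable, so the infima over encoding rules and over rule sequences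
  are taken over nonempty sets.\<close>

lemma enc_rules_nonempty: "(\<lambda>_. undefined) \<in> enc_rules"
  by (simp add: enc_rules_def)

text \<open>\<open>V_le\<close> and \<open>V_greatest\<close> are the two halves of the
  characterization of an infimum. The first one rests on boundedness from below, which comes from
  the nonnegativity of the costs and hence from \<open>\<pi>\<close> being an information
  state.\<close>

lemma V_le:
  assumes "c \<in> {t..} \<rightarrow> enc_rules" "\<pi> \<in> info_states"
  shows "V PX chan \<rho> \<beta> t \<pi> \<le> cost_pi PX chan \<rho> \<beta> c l t \<pi>"
proof -
  have "bdd_below ((\<lambda>(c, l). cost_pi PX chan \<rho> \<beta> c l t \<pi>) ` (({t..} \<rightarrow> enc_rules) \<times> UNIV))"
    using cost_pi_nonneg[OF _ assms(2)] by (intro bdd_belowI2[where m=0]) auto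
  then show ?thesis
    unfolding V_def using assms(1) by (intro cINF_lower2[where x="(c, l)"]) auto
qed

lemma V_greatest:
  assumes "\<And>c l. c \<in> {t..} \<rightarrow> enc_rules \<Longrightarrow> r \<le> cost_pi PX chan \<rho> \<beta> c l t \<pi>"
  shows "r \<le> V PX chan \<rho> \<beta> t \<pi>"
  unfolding V_def
proof (rule cINF_greatest)
  show "({t..} \<rightarrow> enc_rules) \<times> UNIV \<noteq> {}"
    using enc_rules_nonempty by (auto simp: Pi_def)
qed (use assms in auto)

lemma Vhat_le:
  assumes "c \<in> {Suc t..} \<rightarrow> enc_rules" "\<phi> \<in> info_states"
  shows "Vhat PX chan \<rho> \<beta> t \<phi> \<le> cost_phi PX chan \<rho> \<beta> c l t \<phi>"
proof -
  have "bdd_below ((\<lambda>(c, l). cost_phi PX chan \<rho> \<beta> c l t \<phi>) ` (({Suc t..} \<rightarrow> enc_rules) \<times> UNIV))"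
    using cost_phi_nonneg[OF _ assms(2)] by (intro bdd_belowI2[where m=0]) auto
  then show ?thesis
    unfolding Vhat_def using assms(1) by (intro cINF_lower2[where x="(c, l)"]) auto
qed

lemma Vhat_greatest:
  assumes "\<And>c l. c \<in> {Suc t..} \<rightarrow> enc_rules \<Longrightarrow> r \<le> cost_phi PX chan \<rho> \<beta> c l t \<phi>"
  shows "r \<le> Vhat PX chan \<rho> \<beta> t \<phi>"
  unfolding Vhat_def
proof (rule cINF_greatest)
  show "({Suc t..} \<rightarrow> enc_rules) \<times> UNIV \<noteq> {}"
    using enc_rules_nonempty by (auto simp: Pi_def)
qed (use assms in auto)

lemma V_nonneg: "\<pi> \<in> info_states \<Longrightarrow> 0 \<le> V PX chan \<rho> \<beta> t \<pi>"
  by (intro V_greatest cost_pi_nonneg)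

lemma Vhat_nonneg: "\<phi> \<in> info_states \<Longrightarrow> 0 \<le> Vhat PX chan \<rho> \<beta> t \<phi>"
  by (intro Vhat_greatest cost_phi_nonneg)

section \<open>The two dynamic programming equations\<close>

lemma W_inf_le:
  assumes "c \<in> enc_rules" "\<pi> \<in> info_states"
  shows "W_inf chan \<rho> \<beta> (Vhat PX chan \<rho> \<beta> t) \<pi> \<le> W chan \<rho> \<beta> c (Vhat PX chan \<rho> \<beta> t) \<pi>"
  unfolding W_inf_def
proof (rule cINF_lower)
  show "bdd_below ((\<lambda>c. W chan \<rho> \<beta> c (Vhat PX chan \<rho> \<beta> t) \<pi>) ` enc_rules)"
    using Q_info_states[OF _ assms(2)] beta_pos
    by (intro bdd_belowI2[where m=0]) (auto simp: W_def intro!: add_nonneg_nonneg mult_nonneg_nonneg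
          rho_tilde_nonneg Vhat_nonneg)
qed (fact assms(1))

lemma V_eq_W_inf:
  fixes \<pi> :: "('x \<times> (real ^ 'm::finite)) measure"
  assumes \<pi>: "\<pi> \<in> info_states"
  shows "V PX chan \<rho> \<beta> t \<pi> = W_inf chan \<rho> \<beta> (Vhat PX chan \<rho> \<beta> t) \<pi>"
proof (rule antisym)
  show "V PX chan \<rho> \<beta> t \<pi> \<le> W_inf chan \<rho> \<beta> (Vhat PX chan \<rho> \<beta> t) \<pi>"
    unfolding W_inf_def
  proof (rule cINF_greatest)
    fix c0 :: "'x \<times> (real ^ 'm) \<Rightarrow> 'z" assume c0: "c0 \<in> enc_rules"
    \<comment> \<open>The target \<open>V \<le> rho_tilde + \<beta> * Vhat\<close>, solved for
      \<open>Vhat\<close>, is a lower bound on an infimum and can be checked for each continuation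
      separately; solving uses that \<open>\<beta>\<close> is positive.\<close>
    have "(V PX chan \<rho> \<beta> t \<pi> - rho_tilde \<rho> (Q chan c0 \<pi>)) / \<beta> \<le> Vhat PX chan \<rho> \<beta> t (Q chan c0 \<pi>)"
    proof (rule Vhat_greatest)
      fix c :: "nat \<Rightarrow> 'x \<times> (real ^ 'm) \<Rightarrow> 'z" and l assume "c \<in> {Suc t..} \<rightarrow> enc_rules"
      then have "c s \<in> enc_rules" if "t < s" for s
        using that by (intro funcset_mem[of c "{Suc t..}"]) auto
      \<comment> \<open>The continuation is unconstrained at time \<open>t\<close>, so inserting
        \<open>c0\<close> there yields an admissible sequence and leaves the continuation cost
        unchanged.\<close>
      then have c: "c(t := c0) \<in> {t..} \<rightarrow> enc_rules"
        using c0 by (auto simp: Pi_iff order.order_iff_strict)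
      have "cost_phi PX chan \<rho> \<beta> (c(t := c0)) l t \<phi> = cost_phi PX chan \<rho> \<beta> c l t \<phi>" for \<phi>
        unfolding cost_phi_eq_cost_pi by (rule cost_pi_cong) auto
      then have "V PX chan \<rho> \<beta> t \<pi>
          \<le> rho_tilde \<rho> (Q chan c0 \<pi>) + \<beta> * cost_phi PX chan \<rho> \<beta> c l t (Q chan c0 \<pi>)"
        using V_le[OF c \<pi>, of l] cost_pi_rec[OF c \<pi>, of l] by simp
      then show "(V PX chan \<rho> \<beta> t \<pi> - rho_tilde \<rho> (Q chan c0 \<pi>)) / \<beta>
          \<le> cost_phi PX chan \<rho> \<beta> c l t (Q chan c0 \<pi>)"
        using beta_pos by (simp add: field_simps)
    qed
    then show "V PX chan \<rho> \<beta> t \<pi> \<le> W chan \<rho> \<beta> c0 (Vhat PX chan \<rho> \<beta> t) \<pi>"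
      using beta_pos by (simp add: W_def field_simps)
  qed (use enc_rules_nonempty in blast)
  show "W_inf chan \<rho> \<beta> (Vhat PX chan \<rho> \<beta> t) \<pi> \<le> V PX chan \<rho> \<beta> t \<pi>"
  proof (rule V_greatest)
    fix c :: "nat \<Rightarrow> 'x \<times> (real ^ 'm) \<Rightarrow> 'z" and l assume c: "c \<in> {t..} \<rightarrow> enc_rules"
    then have ct: "c t \<in> enc_rules" by auto
    have "W_inf chan \<rho> \<beta> (Vhat PX chan \<rho> \<beta> t) \<pi> \<le> W chan \<rho> \<beta> (c t) (Vhat PX chan \<rho> \<beta> t) \<pi>"
      by (rule W_inf_le[OF ct \<pi>])
    also have "\<dots> \<le> cost_pi PX chan \<rho> \<beta> c l t \<pi>"
      unfolding cost_pi_rec[OF c \<pi>] W_def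
      using c beta_pos Q_info_states[OF ct \<pi>] by (auto intro!: Vhat_le)
    finally show "W_inf chan \<rho> \<beta> (Vhat PX chan \<rho> \<beta> t) \<pi> \<le> cost_pi PX chan \<rho> \<beta> c l t \<pi>" .
  qed
qed

text \<open>The memory update carries neither a cost nor a discount, so the infimum over the rule at
  time \<open>t\<close> and the one over all later rules merge directly.\<close>

lemma Vhat_eq_What_inf:
  fixes \<phi> :: "('x \<times> (real ^ ('y \<times> 'm::finite))) measure"
  assumes \<phi>: "\<phi> \<in> info_states"
  shows "Vhat PX chan \<rho> \<beta> t \<phi> = What_inf PX (V PX chan \<rho> \<beta> (Suc t)) \<phi>"
proof (rule antisym)
  show "Vhat PX chan \<rho> \<beta> t \<phi> \<le> What_inf PX (V PX chan \<rho> \<beta> (Suc t)) \<phi>"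
    unfolding What_inf_def What_def
  proof (rule cINF_greatest)
    fix l0 :: "'y \<times> 'm \<Rightarrow> 'm"
    show "Vhat PX chan \<rho> \<beta> t \<phi> \<le> V PX chan \<rho> \<beta> (Suc t) (Qhat PX l0 \<phi>)"
    proof (rule V_greatest)
      fix c :: "nat \<Rightarrow> 'x \<times> (real ^ 'm) \<Rightarrow> 'z" and l assume c: "c \<in> {Suc t..} \<rightarrow> enc_rules"
      have "cost_pi PX chan \<rho> \<beta> c (l(t := l0)) (Suc t) \<pi> = cost_pi PX chan \<rho> \<beta> c l (Suc t) \<pi>" for \<pi>
        by (rule cost_pi_cong) auto
      then show "Vhat PX chan \<rho> \<beta> t \<phi> \<le> cost_pi PX chan \<rho> \<beta> c l (Suc t) (Qhat PX l0 \<phi>)"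
        using Vhat_le[OF c \<phi>, of "l(t := l0)"] by (simp add: cost_phi_eq_cost_pi)
    qed
  qed simp
  show "What_inf PX (V PX chan \<rho> \<beta> (Suc t)) \<phi> \<le> Vhat PX chan \<rho> \<beta> t \<phi>"
  proof (rule Vhat_greatest)
    fix c :: "nat \<Rightarrow> 'x \<times> (real ^ 'm) \<Rightarrow> 'z" and l assume c: "c \<in> {Suc t..} \<rightarrow> enc_rules"
    \<comment> \<open>There are only finitely many memory rules, so boundedness from below is
      automatic here.\<close>
    have "What_inf PX (V PX chan \<rho> \<beta> (Suc t)) \<phi> \<le> V PX chan \<rho> \<beta> (Suc t) (Qhat PX (l t) \<phi>)"
      unfolding What_inf_def What_def by (rule cINF_lower) auto
    also have "\<dots> \<le> cost_phi PX chan \<rho> \<beta> c l t \<phi>"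
      unfolding cost_phi_eq_cost_pi by (rule V_le[OF c Qhat_info_states[OF \<phi>]])
    finally show "What_inf PX (V PX chan \<rho> \<beta> (Suc t)) \<phi> \<le> cost_phi PX chan \<rho> \<beta> c l t \<phi>" .
  qed
qed

lemma stagewise_minimizers_optimal:
  fixes \<pi> :: "nat \<Rightarrow> ('x \<times> (real ^ 'm::finite)) measure" and l :: "nat \<Rightarrow> 'y \<times> 'm \<Rightarrow> 'm"
  assumes "\<pi> 1 \<in> info_states"
    and c: "\<And>t. t \<ge> 1 \<Longrightarrow> c t \<in> enc_rules"
    and \<phi>: "\<And>t. t \<ge> 1 \<Longrightarrow> \<phi> t = Q chan (c t) (\<pi> t)"
    and \<pi>: "\<And>t. t \<ge> 1 \<Longrightarrow> \<pi> (Suc t) = Qhat PX (l t) (\<phi> t)"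
    and W: "\<And>t. t \<ge> 1 \<Longrightarrow> W chan \<rho> \<beta> (c t) (Vhat PX chan \<rho> \<beta> t) (\<pi> t)
             = W_inf chan \<rho> \<beta> (Vhat PX chan \<rho> \<beta> t) (\<pi> t)"
    and What: "\<And>t. t \<ge> 1 \<Longrightarrow> What PX (l t) (V PX chan \<rho> \<beta> (Suc t)) (\<phi> t)
             = What_inf PX (V PX chan \<rho> \<beta> (Suc t)) (\<phi> t)"
    and c': "\<And>t. t \<ge> 1 \<Longrightarrow> c' t \<in> enc_rules"
  shows "cost_pi PX chan \<rho> \<beta> c l 1 (\<pi> 1) \<le> cost_pi PX chan \<rho> \<beta> c' l' 1 (\<pi> 1)"
proof -
  have path: "\<pi> (Suc k) = pi_path PX chan c l 1 (\<pi> 1) k" for k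
    by (induction k) (simp_all add: \<phi> \<pi>)
  have cP: "c \<in> {1..} \<rightarrow> enc_rules" using c by auto
  have info: "\<pi> (Suc k) \<in> info_states" "\<phi> (Suc k) \<in> info_states" for k
    unfolding \<phi>[of "Suc k", simplified] path
    using pi_path_info_states[OF cP assms(1)] c by (auto intro!: Q_info_states)
  have step: "V PX chan \<rho> \<beta> (Suc k) (\<pi> (Suc k))
      = rho_tilde \<rho> (\<phi> (Suc k)) + \<beta> * V PX chan \<rho> \<beta> (Suc (Suc k)) (\<pi> (Suc (Suc k)))" for k
  proof -
    have "V PX chan \<rho> \<beta> (Suc k) (\<pi> (Suc k)) = W chan \<rho> \<beta> (c (Suc k)) (Vhat PX chan \<rho> \<beta> (Suc k)) (\<pi> (Suc k))"
      using V_eq_W_inf[OF info(1)] W[of "Suc k"] by simp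
    also have "\<dots> = rho_tilde \<rho> (\<phi> (Suc k)) + \<beta> * Vhat PX chan \<rho> \<beta> (Suc k) (\<phi> (Suc k))"
      by (simp add: W_def \<phi>)
    also have "Vhat PX chan \<rho> \<beta> (Suc k) (\<phi> (Suc k)) = V PX chan \<rho> \<beta> (Suc (Suc k)) (\<pi> (Suc (Suc k)))"
      using Vhat_eq_What_inf[OF info(2)] What[of "Suc k"] \<pi>[of "Suc k"] by (simp add: What_def)
    finally show ?thesis .
  qed
  have telescope: "V PX chan \<rho> \<beta> 1 (\<pi> 1)
      = (\<Sum>k<n. \<beta> ^ k * rho_tilde \<rho> (\<phi> (Suc k))) + \<beta> ^ n * V PX chan \<rho> \<beta> (Suc n) (\<pi> (Suc n))" for n
  proof (induction n)
    case (Suc n)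
    show ?case
      unfolding Suc by (subst step) (simp add: algebra_simps)
  qed simp
  have "cost_pi PX chan \<rho> \<beta> c l 1 (\<pi> 1) = (\<Sum>k. \<beta> ^ k * rho_tilde \<rho> (\<phi> (Suc k)))"
    unfolding cost_pi_def path[symmetric] by (simp add: \<phi>)
  also have "\<dots> \<le> V PX chan \<rho> \<beta> 1 (\<pi> 1)"
  proof (rule suminf_le_const)
    show "(\<Sum>k<n. \<beta> ^ k * rho_tilde \<rho> (\<phi> (Suc k))) \<le> V PX chan \<rho> \<beta> 1 (\<pi> 1)" for n
      unfolding telescope[of n] using V_nonneg[OF info(1), of "Suc n" n] beta_pos by simp
  qed (rule discounted_summable[OF info(2)])
  also have "\<dots> \<le> cost_pi PX chan \<rho> \<beta> c' l' 1 (\<pi> 1)"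
    by (rule V_le) (use assms(1) c' in auto)
  finally show ?thesis .
qed

end

section \<open>Conditioning on finitely many histories\<close>

lemma count_space_event:
  assumes "f \<in> M \<rightarrow>\<^sub>M count_space UNIV" shows "{\<omega>\<in>space M. P (f \<omega>)} \<in> sets M"
  using measurable_sets[OF assms, of "Collect P"] by (simp add: vimage_def Int_def conj_commute)

lemma measurable_Pair_finite:
  fixes f :: "'a \<Rightarrow> 'b::finite" and g :: "'a \<Rightarrow> 'c::finite"
  assumes "f \<in> M \<rightarrow>\<^sub>M count_space UNIV" "g \<in> M \<rightarrow>\<^sub>M count_space UNIV"
  shows "(\<lambda>a. (f a, g a)) \<in> M \<rightarrow>\<^sub>M count_space UNIV"
  using measurable_Pair[OF assms] by (simp add: pair_measure_count_space)

lemma (in prob_space) expectation_finite: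
  fixes f :: "'a \<Rightarrow> 'b::finite" and r :: "'b \<Rightarrow> real"
  assumes "f \<in> M \<rightarrow>\<^sub>M count_space UNIV"
  shows "expectation (\<lambda>\<omega>. r (f \<omega>)) = (\<Sum>a\<in>UNIV. r a * prob {\<omega>\<in>space M. f \<omega> = a})"
proof -
  have sets: "{\<omega>\<in>space M. f \<omega> = a} \<in> events" for a
    using assms by measurable
  have "expectation (\<lambda>\<omega>. r (f \<omega>))
      = expectation (\<lambda>\<omega>. \<Sum>a\<in>UNIV. r a * indicator {\<omega>\<in>space M. f \<omega> = a} \<omega>)"
    by (rule Bochner_Integration.integral_cong) (auto simp: indicator_def if_distrib sum.delta cong: if_cong)
  also have "\<dots> = (\<Sum>a\<in>UNIV. expectation (\<lambda>\<omega>. r a * indicator {\<omega>\<in>space M. f \<omega> = a} \<omega>))"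
    using sets by (intro Bochner_Integration.integral_sum)
      (auto intro!: integrable_mult_right integrable_real_indicator simp: emeasure_eq_measure)
  also have "\<dots> = (\<Sum>a\<in>UNIV. r a * prob {\<omega>\<in>space M. f \<omega> = a})"
    using sets by (simp add: Int_absorb2)
  finally show ?thesis .
qed

text \<open>The variables \<open>T\<close> will be histories, with values in an infinite function
  type. Hence finiteness is asked of the range and measurability of the single fibres, in place of
  measurability into a finite count space.\<close>

lemma (in prob_space) prob_split:
  assumes "finite (T ` space M)"
    and "\<And>v. {\<omega>\<in>space M. T \<omega> = v} \<in> events"
    and "E \<in> events"
  shows "prob E = (\<Sum>v\<in>T ` space M. prob {\<omega>\<in>E. T \<omega> = v})"
proof -
  have sub: "E \<subseteq> space M" using assms(3) by (rule sets.sets_into_space)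
  have eq: "{\<omega>\<in>E. T \<omega> = v} = E \<inter> {\<omega>\<in>space M. T \<omega> = v}" for v
    using sub by auto
  have "prob (\<Union>v\<in>T ` space M. {\<omega>\<in>E. T \<omega> = v}) = (\<Sum>v\<in>T ` space M. prob {\<omega>\<in>E. T \<omega> = v})"
    using assms by (intro finite_measure_finite_Union) (auto simp: disjoint_family_on_def eq)
  moreover have "(\<Union>v\<in>T ` space M. {\<omega>\<in>E. T \<omega> = v}) = E" using sub by auto
  ultimately show ?thesis by simp
qed

text \<open>A conditional probability with the same value on all fibres of \<open>T\<close> inside
  \<open>E\<close> is also the conditional probability given \<open>E\<close>. It serves to average
  out the outputs, which the encoder does not observe.\<close>

lemma (in prob_space) prob_fibers_proportional:
  assumes T: "finite (T ` space M)" "\<And>v. {\<omega>\<in>space M. T \<omega> = v} \<in> events"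
    and E: "E \<in> events" and B: "B \<in> events"
    and k: "\<And>\<omega>1. \<omega>1 \<in> E \<Longrightarrow> prob {\<omega>\<in>E \<inter> B. T \<omega> = T \<omega>1} = k * prob {\<omega>\<in>E. T \<omega> = T \<omega>1}"
  shows "prob (E \<inter> B) = k * prob E"
proof -
  have "prob {\<omega>\<in>E \<inter> B. T \<omega> = v} = k * prob {\<omega>\<in>E. T \<omega> = v}" for v
  \<comment> \<open>The hypothesis speaks of the values that \<open>T\<close> takes on
    \<open>E\<close>; for any other value both fibres are empty.\<close>
  proof (cases "\<exists>\<omega>1\<in>E. T \<omega>1 = v")
    case True
    then show ?thesis using k by auto
  next
    case False
    then have *: "{\<omega>\<in>E. T \<omega> = v} = {}" by blast
    then have "{\<omega>\<in>E \<inter> B. T \<omega> = v} = {}" by blast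
    with * show ?thesis by (simp only: measure_empty mult_zero_right)
  qed
  then show ?thesis
    using E B by (simp add: prob_split[OF T] sum_distrib_left)
qed

text \<open>The tower property for a conditioning variable of finite range: given \<open>T\<close>,
  the variable \<open>f\<close> has law \<open>k\<close>, and both sides are finite sums over the
  fibres of \<open>T\<close>. Constancy of \<open>G\<close> and \<open>k\<close> on fibres takes the
  place of measurability with respect to \<open>T\<close>.\<close>

lemma (in prob_space) nn_integral_condition:
  fixes f :: "'a \<Rightarrow> 'b::finite" and k :: "'a \<Rightarrow> 'b \<Rightarrow> real" and G :: "'a \<Rightarrow> 'b \<Rightarrow> ennreal"
  assumes T: "finite (T ` space M)" "\<And>v. {\<omega>\<in>space M. T \<omega> = v} \<in> events"
    and f: "f \<in> M \<rightarrow>\<^sub>M count_space UNIV"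
    and G: "\<And>\<omega> \<omega>' a. \<omega> \<in> space M \<Longrightarrow> \<omega>' \<in> space M \<Longrightarrow> T \<omega> = T \<omega>' \<Longrightarrow> G \<omega> a = G \<omega>' a"
    and k: "\<And>\<omega> \<omega>' a. \<omega> \<in> space M \<Longrightarrow> \<omega>' \<in> space M \<Longrightarrow> T \<omega> = T \<omega>' \<Longrightarrow> k \<omega> a = k \<omega>' a"
    and prob: "\<And>\<omega>0 a. \<omega>0 \<in> space M \<Longrightarrow>
      prob {\<omega>\<in>space M. T \<omega> = T \<omega>0 \<and> f \<omega> = a} = k \<omega>0 a * prob {\<omega>\<in>space M. T \<omega> = T \<omega>0}"
    and k_nonneg: "\<And>\<omega> a. 0 \<le> k \<omega> a"
  shows "(\<integral>\<^sup>+\<omega>. G \<omega> (f \<omega>) \<partial>M) = (\<integral>\<^sup>+\<omega>. (\<Sum>a\<in>UNIV. ennreal (k \<omega> a) * G \<omega> a) \<partial>M)"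
proof -
  define S where "S = T ` space M"
  \<comment> \<open>A representative outcome of each fibre; evaluating \<open>G\<close> and
    \<open>k\<close> there turns both integrands into finite combinations of indicators.\<close>
  define r where "r v = (SOME \<omega>. \<omega> \<in> space M \<and> T \<omega> = v)" for v
  have r: "r v \<in> space M" "T (r v) = v" if "v \<in> S" for v
  proof -
    have "r v \<in> space M \<and> T (r v) = v"
      unfolding r_def by (rule someI_ex) (use that in \<open>auto simp: S_def\<close>)
    then show "r v \<in> space M" "T (r v) = v" by auto
  qed
  have S: "finite S" "\<And>\<omega>. \<omega> \<in> space M \<Longrightarrow> T \<omega> \<in> S"
    using T(1) by (auto simp: S_def)
  have f_sets: "{\<omega>\<in>space M. f \<omega> = a} \<in> events" for a
    using f by measurable
  have Tf_sets: "{\<omega>\<in>space M. T \<omega> = v \<and> f \<omega> = a} \<in> events" for v a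
    using sets.Int[OF T(2)[of v] f_sets[of a]] by (simp add: Int_def conj_commute conj_left_commute)
  have "(\<integral>\<^sup>+\<omega>. G \<omega> (f \<omega>) \<partial>M)
      = (\<integral>\<^sup>+\<omega>. (\<Sum>v\<in>S. \<Sum>a\<in>UNIV. G (r v) a * indicator {\<omega>\<in>space M. T \<omega> = v \<and> f \<omega> = a} \<omega>) \<partial>M)"
  proof (rule nn_integral_cong)
    fix \<omega> assume \<omega>: "\<omega> \<in> space M"
    have "(\<Sum>v\<in>S. \<Sum>a\<in>UNIV. G (r v) a * indicator {\<omega>\<in>space M. T \<omega> = v \<and> f \<omega> = a} \<omega>)
        = (\<Sum>v\<in>S. if v = T \<omega> then \<Sum>a\<in>UNIV. if a = f \<omega> then G (r v) a else 0 else 0)"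
      using \<omega> by (intro sum.cong refl) (auto simp: indicator_def intro!: sum.cong sum.neutral)
    also have "\<dots> = G (r (T \<omega>)) (f \<omega>)"
      using S \<omega> by (simp add: sum.delta)
    also have "\<dots> = G \<omega> (f \<omega>)"
      using r[OF S(2)[OF \<omega>]] \<omega> by (intro G) auto
    finally show "G \<omega> (f \<omega>)
        = (\<Sum>v\<in>S. \<Sum>a\<in>UNIV. G (r v) a * indicator {\<omega>\<in>space M. T \<omega> = v \<and> f \<omega> = a} \<omega>)" ..
  qed
  also have "\<dots> = (\<Sum>v\<in>S. \<Sum>a\<in>UNIV. G (r v) a * emeasure M {\<omega>\<in>space M. T \<omega> = v \<and> f \<omega> = a})"
    using Tf_sets by (subst nn_integral_sum, measurable)+ (simp add: nn_integral_cmult_indicator)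
  also have "\<dots> = (\<Sum>v\<in>S. (\<Sum>a\<in>UNIV. ennreal (k (r v) a) * G (r v) a) * emeasure M {\<omega>\<in>space M. T \<omega> = v})"
    unfolding sum_distrib_right
  proof (intro sum.cong refl)
    fix v a assume "v \<in> S"
    then show "G (r v) a * emeasure M {\<omega>\<in>space M. T \<omega> = v \<and> f \<omega> = a}
        = ennreal (k (r v) a) * G (r v) a * emeasure M {\<omega>\<in>space M. T \<omega> = v}"
      using prob[OF r(1), of v a] r(2)[of v] k_nonneg
      by (simp add: emeasure_eq_measure ennreal_mult mult_ac)
  qed
  also have "\<dots> = (\<integral>\<^sup>+\<omega>. (\<Sum>v\<in>S. (\<Sum>a\<in>UNIV. ennreal (k (r v) a) * G (r v) a)
      * indicator {\<omega>\<in>space M. T \<omega> = v} \<omega>) \<partial>M)"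
    using T(2) by (subst nn_integral_sum, measurable) (simp add: nn_integral_cmult_indicator)
  also have "\<dots> = (\<integral>\<^sup>+\<omega>. (\<Sum>a\<in>UNIV. ennreal (k \<omega> a) * G \<omega> a) \<partial>M)"
  proof (rule nn_integral_cong)
    fix \<omega> assume \<omega>: "\<omega> \<in> space M"
    have "(\<Sum>v\<in>S. (\<Sum>a\<in>UNIV. ennreal (k (r v) a) * G (r v) a) * indicator {\<omega>\<in>space M. T \<omega> = v} \<omega>)
        = (\<Sum>v\<in>S. if v = T \<omega> then \<Sum>a\<in>UNIV. ennreal (k (r v) a) * G (r v) a else 0)"
      using \<omega> by (intro sum.cong refl) (auto simp: indicator_def)
    also have "\<dots> = (\<Sum>a\<in>UNIV. ennreal (k (r (T \<omega>)) a) * G (r (T \<omega>)) a)"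
      using S \<omega> by (simp add: sum.delta)
    also have "\<dots> = (\<Sum>a\<in>UNIV. ennreal (k \<omega> a) * G \<omega> a)"
      using r[OF S(2)[OF \<omega>]] \<omega> G[of "r (T \<omega>)" \<omega>] k[of "r (T \<omega>)" \<omega>] by simp
    finally show "(\<Sum>v\<in>S. (\<Sum>a\<in>UNIV. ennreal (k (r v) a) * G (r v) a) * indicator {\<omega>\<in>space M. T \<omega> = v} \<omega>)
        = (\<Sum>a\<in>UNIV. ennreal (k \<omega> a) * G \<omega> a)" .
  qed
  finally show ?thesis .
qed

text \<open>Finitely many null fibres have a null union. Almost surely, conditional probabilities
  given the observed history are therefore genuine quotients, which permits the cancellation in
  \<open>belief_update\<close>.\<close>

lemma (in prob_space) AE_fiber_pos:
  assumes T: "finite (T ` space M)" "\<And>v. {\<omega>\<in>space M. T \<omega> = v} \<in> events"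
  shows "AE \<omega> in M. 0 < prob {\<omega>'\<in>space M. T \<omega>' = T \<omega>}"
proof -
  define S where "S = {v \<in> T ` space M. prob {\<omega>\<in>space M. T \<omega> = v} = 0}"
  have "(\<Union>v\<in>S. {\<omega>\<in>space M. T \<omega> = v}) \<in> null_sets M"
    using T by (intro null_sets_UN' countable_finite) (auto simp: S_def emeasure_eq_measure)
  moreover have "{\<omega>\<in>space M. \<not> 0 < prob {\<omega>'\<in>space M. T \<omega>' = T \<omega>}} \<subseteq> (\<Union>v\<in>S. {\<omega>\<in>space M. T \<omega> = v})"
    by (auto simp: S_def not_less measure_le_0_iff)
  ultimately show ?thesis by (rule AE_I')
qed

section \<open>Realizations of the system\<close>

locale realization = prob_space \<Omega> for \<Omega> :: "'o measure" +
  fixes muX :: "'x::finite pmf" and PX :: "'x \<Rightarrow> 'x pmf"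
    and chan :: "'z::finite \<Rightarrow> 'y::finite pmf" and m0 :: "'m::finite"
    and c :: "nat \<Rightarrow> 'x \<times> (real ^ 'm) \<Rightarrow> 'z" and l :: "nat \<Rightarrow> 'y \<times> 'm \<Rightarrow> 'm"
    and X :: "nat \<Rightarrow> 'o \<Rightarrow> 'x" and Z :: "nat \<Rightarrow> 'o \<Rightarrow> 'z" and Y :: "nat \<Rightarrow> 'o \<Rightarrow> 'y"
  assumes is_realization: "is_realization muX PX chan m0 c l \<Omega> X Z Y"
begin

section \<open>Encoder and output histories\<close>

abbreviation mem :: "nat \<Rightarrow> 'o \<Rightarrow> 'm" where
  "mem \<equiv> memory m0 l Y"

abbreviation bel :: "nat \<Rightarrow> 'o \<Rightarrow> real ^ 'm" where
  "bel \<equiv> belief \<Omega> X Z mem"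

text \<open>The restriction makes equality of values the same as agreement at times 1 to
  \<open>t\<close>, which is the conditioning event of \<open>belief\<close>. For
  \<open>t = 0\<close> all outcomes share one history.\<close>

definition enc_hist :: "nat \<Rightarrow> 'o \<Rightarrow> nat \<Rightarrow> 'x \<times> 'z" where
  "enc_hist t \<omega> = restrict (\<lambda>s. (X s \<omega>, Z s \<omega>)) {1..t}"

definition out_hist :: "nat \<Rightarrow> 'o \<Rightarrow> nat \<Rightarrow> 'y" where
  "out_hist t \<omega> = restrict (\<lambda>s. Y s \<omega>) {1..t}"

lemma restrict_eq_iff: "restrict f A = restrict g A \<longleftrightarrow> (\<forall>s\<in>A. f s = g s)"
  by (auto simp: restrict_def fun_eq_iff)

lemma enc_hist_eq_iff:
  "enc_hist t \<omega> = enc_hist t \<omega>' \<longleftrightarrow> (\<forall>s\<in>{1..t}. X s \<omega> = X s \<omega>' \<and> Z s \<omega> = Z s \<omega>')"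
  unfolding enc_hist_def restrict_eq_iff by simp

lemma out_hist_eq_iff:
  "out_hist t \<omega> = out_hist t \<omega>' \<longleftrightarrow> (\<forall>s\<in>{1..t}. Y s \<omega> = Y s \<omega>')"
  unfolding out_hist_def restrict_eq_iff by simp

lemma enc_hist_Suc_eq_iff:
  "enc_hist (Suc t) \<omega> = enc_hist (Suc t) \<omega>' \<longleftrightarrow>
    enc_hist t \<omega> = enc_hist t \<omega>' \<and> X (Suc t) \<omega> = X (Suc t) \<omega>' \<and> Z (Suc t) \<omega> = Z (Suc t) \<omega>'"
  unfolding enc_hist_eq_iff by (auto simp: atLeastAtMostSuc_conv)

lemma X_eqI: "enc_hist t \<omega> = enc_hist t \<omega>' \<Longrightarrow> 1 \<le> t \<Longrightarrow> X t \<omega> = X t \<omega>'"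
  unfolding enc_hist_eq_iff by simp

lemmas realization_conditions = is_realization[unfolded is_realization_def]

lemmas source_law = realization_conditions[THEN conjunct2, THEN conjunct2, THEN conjunct2,
    THEN conjunct1, THEN spec, THEN mp, THEN spec, THEN spec, THEN spec, THEN spec, THEN mp]

lemmas channel_law = realization_conditions[THEN conjunct2, THEN conjunct2, THEN conjunct2,
    THEN conjunct2, THEN conjunct1, THEN spec, THEN mp, THEN spec, THEN spec, THEN spec, THEN spec, THEN mp]

lemmas encoder_law = realization_conditions[THEN conjunct2, THEN conjunct2, THEN conjunct2,
    THEN conjunct2, THEN conjunct2, THEN spec, THEN mp]

lemma measurable_process [measurable]:
  assumes "1 \<le> t"
  shows "X t \<in> \<Omega> \<rightarrow>\<^sub>M count_space UNIV" "Z t \<in> \<Omega> \<rightarrow>\<^sub>M count_space UNIV"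
    "Y t \<in> \<Omega> \<rightarrow>\<^sub>M count_space UNIV"
  using assms realization_conditions[THEN conjunct2, THEN conjunct1] by blast+

lemma measurable_mem [measurable]: "mem t \<in> \<Omega> \<rightarrow>\<^sub>M count_space UNIV"
proof (induction t)
  case (Suc t)
  have "(\<lambda>\<omega>. l (Suc t) (Y (Suc t) \<omega>, mem t \<omega>)) \<in> \<Omega> \<rightarrow>\<^sub>M count_space UNIV"
    by (rule measurable_compose[OF measurable_Pair_finite[OF measurable_process(3) Suc]]) simp_all
  then show ?case by simp
qed simp

lemma finite_enc_hist: "finite (enc_hist t ` space \<Omega>)"
proof (rule finite_subset)
  show "enc_hist t ` space \<Omega> \<subseteq> PiE {1..t} (\<lambda>_. UNIV)" by (auto simp: enc_hist_def)
qed (simp add: finite_PiE)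

lemma finite_out_hist: "finite (out_hist t ` space \<Omega>)"
proof (rule finite_subset)
  show "out_hist t ` space \<Omega> \<subseteq> PiE {1..t} (\<lambda>_. UNIV)" by (auto simp: out_hist_def)
qed (simp add: finite_PiE)

lemma enc_hist_event: "{\<omega>\<in>space \<Omega>. enc_hist t \<omega> = v} \<in> events"
proof (cases "\<exists>\<omega>0. v = enc_hist t \<omega>0")
  case True
  then obtain \<omega>0 where v: "v = enc_hist t \<omega>0" by blast
  have "{\<omega>\<in>space \<Omega>. X s \<omega> = X s \<omega>0 \<and> Z s \<omega> = Z s \<omega>0} \<in> events" if "s \<in> {1..t}" for s
    using that by (intro sets.sets_Collect_conj count_space_event measurable_process) auto
  then show ?thesis unfolding v enc_hist_eq_iff by (rule sets.sets_Collect_finite_All) auto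
next
  case False
  then have "{\<omega>\<in>space \<Omega>. enc_hist t \<omega> = v} = {}" by blast
  then show ?thesis by (simp only: sets.empty_sets)
qed

lemma out_hist_event: "{\<omega>\<in>space \<Omega>. out_hist t \<omega> = v} \<in> events"
proof (cases "\<exists>\<omega>0. v = out_hist t \<omega>0")
  case True
  then obtain \<omega>0 where v: "v = out_hist t \<omega>0" by blast
  have "{\<omega>\<in>space \<Omega>. Y s \<omega> = Y s \<omega>0} \<in> events" if "s \<in> {1..t}" for s
    using that by (intro count_space_event measurable_process) auto
  then show ?thesis unfolding v out_hist_eq_iff by (rule sets.sets_Collect_finite_All) auto
next
  case False
  then have "{\<omega>\<in>space \<Omega>. out_hist t \<omega> = v} = {}" by blast
  then show ?thesis by (simp only: sets.empty_sets)
qed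

lemma X_event: "{\<omega>\<in>space \<Omega>. X (Suc t) \<omega> = x} \<in> events"
  and Y_event: "{\<omega>\<in>space \<Omega>. Y (Suc t) \<omega> = y} \<in> events"
  and mem_event: "{\<omega>\<in>space \<Omega>. P (mem t \<omega>)} \<in> events"
  by (intro count_space_event measurable_process measurable_mem, simp)+

lemmas history_events = enc_hist_event out_hist_event X_event Y_event mem_event

text \<open>The memory is driven by the outputs alone, through fixed rules, so events about it are
  unions of fibres of \<open>out_hist\<close>.\<close>

lemma mem_eqI: "out_hist t \<omega> = out_hist t \<omega>' \<Longrightarrow> mem t \<omega> = mem t \<omega>'"
  unfolding out_hist_eq_iff by (induction t) auto

lemma bel_eqI: "enc_hist t \<omega> = enc_hist t \<omega>' \<Longrightarrow> bel t \<omega> = bel t \<omega>'"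
proof -
  assume "enc_hist t \<omega> = enc_hist t \<omega>'"
  then have "\<forall>s\<in>{1..t}. X s \<omega> = X s \<omega>' \<and> Z s \<omega> = Z s \<omega>'"
    unfolding enc_hist_eq_iff .
  then have "(\<lambda>\<omega>''. \<forall>s\<in>{1..t}. X s \<omega>'' = X s \<omega> \<and> Z s \<omega>'' = Z s \<omega>)
      = (\<lambda>\<omega>''. \<forall>s\<in>{1..t}. X s \<omega>'' = X s \<omega>' \<and> Z s \<omega>'' = Z s \<omega>')"
    by (simp add: fun_eq_iff)
  then show ?thesis by (simp only: belief_def)
qed

text \<open>The product form also covers conditioning events of probability zero, where both sides
  vanish, so the resulting identities can be summed over all histories.\<close>

lemma conditional_product:
  assumes "0 < prob {\<omega>\<in>space \<Omega>. B \<omega>} \<Longrightarrow> \<P>(\<omega> in \<Omega>. A \<omega> \<bar> B \<omega>) = r"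
    and "{\<omega>\<in>space \<Omega>. B \<omega>} \<in> events"
  shows "prob {\<omega>\<in>space \<Omega>. B \<omega> \<and> A \<omega>} = r * prob {\<omega>\<in>space \<Omega>. B \<omega>}"
proof (cases "prob {\<omega>\<in>space \<Omega>. B \<omega>} = 0")
  case True
  then have "prob {\<omega>\<in>space \<Omega>. B \<omega> \<and> A \<omega>} \<le> 0"
    using finite_measure_mono[OF _ assms(2), of "{\<omega>\<in>space \<Omega>. B \<omega> \<and> A \<omega>}"] by auto
  with True show ?thesis by (simp add: measure_le_0_iff)
next
  case False
  then have "0 < prob {\<omega>\<in>space \<Omega>. B \<omega>}" by (simp add: zero_less_measure_iff)
  from assms(1)[OF this] this show ?thesis by (auto simp: cond_prob_def conj_commute)
qed

section \<open>One-step laws of source and channel\<close>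

lemma source_step:
  assumes t: "1 \<le> t"
  shows "prob {\<omega>\<in>space \<Omega>. (enc_hist t \<omega> = enc_hist t \<omega>1 \<and> out_hist t \<omega> = out_hist t \<omega>1) \<and> X (Suc t) \<omega> = x'}
    = pmf (PX (X t \<omega>1)) x'
      * prob {\<omega>\<in>space \<Omega>. enc_hist t \<omega> = enc_hist t \<omega>1 \<and> out_hist t \<omega> = out_hist t \<omega>1}"
proof (rule conditional_product)
  show "{\<omega>\<in>space \<Omega>. enc_hist t \<omega> = enc_hist t \<omega>1 \<and> out_hist t \<omega> = out_hist t \<omega>1} \<in> events"
    by (intro sets.sets_Collect_conj history_events)
  have eq: "(enc_hist t \<omega> = enc_hist t \<omega>1 \<and> out_hist t \<omega> = out_hist t \<omega>1)
      \<longleftrightarrow> (\<forall>s\<in>{1..t}. X s \<omega> = X s \<omega>1 \<and> Z s \<omega> = Z s \<omega>1 \<and> Y s \<omega> = Y s \<omega>1)" for \<omega>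
    unfolding enc_hist_eq_iff out_hist_eq_iff by auto
  assume "0 < prob {\<omega>\<in>space \<Omega>. enc_hist t \<omega> = enc_hist t \<omega>1 \<and> out_hist t \<omega> = out_hist t \<omega>1}"
  then show "\<P>(\<omega> in \<Omega>. X (Suc t) \<omega> = x' \<bar> enc_hist t \<omega> = enc_hist t \<omega>1 \<and> out_hist t \<omega> = out_hist t \<omega>1)
      = pmf (PX (X t \<omega>1)) x'"
    unfolding eq by (rule source_law[OF t])
qed

lemma channel_step:
  shows "prob {\<omega>\<in>space \<Omega>. (enc_hist (Suc t) \<omega> = enc_hist (Suc t) \<omega>1 \<and> out_hist t \<omega> = out_hist t \<omega>1)
        \<and> Y (Suc t) \<omega> = y}
    = pmf (chan (Z (Suc t) \<omega>1)) y
      * prob {\<omega>\<in>space \<Omega>. enc_hist (Suc t) \<omega> = enc_hist (Suc t) \<omega>1 \<and> out_hist t \<omega> = out_hist t \<omega>1}"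
proof (rule conditional_product)
  show "{\<omega>\<in>space \<Omega>. enc_hist (Suc t) \<omega> = enc_hist (Suc t) \<omega>1 \<and> out_hist t \<omega> = out_hist t \<omega>1} \<in> events"
    by (intro sets.sets_Collect_conj history_events)
  \<comment> \<open>The condition contains the new input at \<open>Suc t\<close> but only the
    outputs up to \<open>t\<close>; this matches the half-open range of output times in the channel
    law.\<close>
  have eq: "(enc_hist (Suc t) \<omega> = enc_hist (Suc t) \<omega>1 \<and> out_hist t \<omega> = out_hist t \<omega>1)
      \<longleftrightarrow> (\<forall>s\<in>{1..Suc t}. X s \<omega> = X s \<omega>1 \<and> Z s \<omega> = Z s \<omega>1) \<and> (\<forall>s\<in>{1..<Suc t}. Y s \<omega> = Y s \<omega>1)" for \<omega>
    unfolding enc_hist_eq_iff out_hist_eq_iff atLeastLessThanSuc_atLeastAtMost ..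
  have "1 \<le> Suc t" by simp
  assume "0 < prob {\<omega>\<in>space \<Omega>. enc_hist (Suc t) \<omega> = enc_hist (Suc t) \<omega>1 \<and> out_hist t \<omega> = out_hist t \<omega>1}"
  then show "\<P>(\<omega> in \<Omega>. Y (Suc t) \<omega> = y \<bar>
        enc_hist (Suc t) \<omega> = enc_hist (Suc t) \<omega>1 \<and> out_hist t \<omega> = out_hist t \<omega>1)
      = pmf (chan (Z (Suc t) \<omega>1)) y"
    unfolding eq by (rule channel_law[OF \<open>1 \<le> Suc t\<close>])
qed

text \<open>The encoder history fixes \<open>X t\<close>, so the factor of
  \<open>source_step\<close> is the same for all output histories compatible with \<open>P\<close>
  and survives summation over them. The trivial \<open>P\<close> gives the law of the next symbol
  alone; combined with a \<open>P\<close> naming one memory value it yields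
  \<open>bel_product_X\<close>.\<close>

lemma source_step_mem:
  assumes t: "1 \<le> t"
  shows "prob {\<omega>\<in>space \<Omega>. enc_hist t \<omega> = enc_hist t \<omega>0 \<and> X (Suc t) \<omega> = x' \<and> P (mem t \<omega>)}
    = pmf (PX (X t \<omega>0)) x' * prob {\<omega>\<in>space \<Omega>. enc_hist t \<omega> = enc_hist t \<omega>0 \<and> P (mem t \<omega>)}"
proof -
  let ?E = "{\<omega>\<in>space \<Omega>. enc_hist t \<omega> = enc_hist t \<omega>0 \<and> P (mem t \<omega>)}"
  let ?B = "{\<omega>\<in>space \<Omega>. X (Suc t) \<omega> = x'}"
  have "prob (?E \<inter> ?B) = pmf (PX (X t \<omega>0)) x' * prob ?E"
  proof (rule prob_fibers_proportional[OF finite_out_hist out_hist_event])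
    fix \<omega>1 assume "\<omega>1 \<in> ?E"
    then have \<omega>1: "enc_hist t \<omega>1 = enc_hist t \<omega>0" "P (mem t \<omega>1)" by auto
    have mem: "P (mem t \<omega>)" if "out_hist t \<omega> = out_hist t \<omega>1" for \<omega>
      using mem_eqI[OF that] \<omega>1(2) by simp
    have "{\<omega>\<in>?E. out_hist t \<omega> = out_hist t \<omega>1}
        = {\<omega>\<in>space \<Omega>. enc_hist t \<omega> = enc_hist t \<omega>1 \<and> out_hist t \<omega> = out_hist t \<omega>1}"
      and "{\<omega>\<in>?E \<inter> ?B. out_hist t \<omega> = out_hist t \<omega>1}
        = {\<omega>\<in>space \<Omega>. (enc_hist t \<omega> = enc_hist t \<omega>1 \<and> out_hist t \<omega> = out_hist t \<omega>1) \<and> X (Suc t) \<omega> = x'}"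
      using \<omega>1(1) mem by auto
    then show "prob {\<omega>\<in>?E \<inter> ?B. out_hist t \<omega> = out_hist t \<omega>1}
        = pmf (PX (X t \<omega>0)) x' * prob {\<omega>\<in>?E. out_hist t \<omega> = out_hist t \<omega>1}"
      using source_step[OF t, of \<omega>1 x'] X_eqI[OF \<omega>1(1) t] by (simp only:)
  qed (intro sets.sets_Collect_conj history_events)+
  moreover have "?E \<inter> ?B = {\<omega>\<in>space \<Omega>. enc_hist t \<omega> = enc_hist t \<omega>0 \<and> X (Suc t) \<omega> = x' \<and> P (mem t \<omega>)}"
    by auto
  ultimately show ?thesis by simp
qed

text \<open>The same averaging over output histories; the common factor now depends on the current
  channel input, which is part of the encoder history.\<close>

lemma channel_step_mem:
  "prob {\<omega>\<in>space \<Omega>. enc_hist (Suc t) \<omega> = enc_hist (Suc t) \<omega>0 \<and> mem t \<omega> = m \<and> Y (Suc t) \<omega> = y}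
    = pmf (chan (Z (Suc t) \<omega>0)) y
      * prob {\<omega>\<in>space \<Omega>. enc_hist (Suc t) \<omega> = enc_hist (Suc t) \<omega>0 \<and> mem t \<omega> = m}"
proof -
  let ?E = "{\<omega>\<in>space \<Omega>. enc_hist (Suc t) \<omega> = enc_hist (Suc t) \<omega>0 \<and> mem t \<omega> = m}"
  let ?B = "{\<omega>\<in>space \<Omega>. Y (Suc t) \<omega> = y}"
  have "prob (?E \<inter> ?B) = pmf (chan (Z (Suc t) \<omega>0)) y * prob ?E"
  proof (rule prob_fibers_proportional[OF finite_out_hist out_hist_event])
    fix \<omega>1 assume "\<omega>1 \<in> ?E"
    then have \<omega>1: "enc_hist (Suc t) \<omega>1 = enc_hist (Suc t) \<omega>0" "mem t \<omega>1 = m" by auto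
    have mem: "mem t \<omega> = m" if "out_hist t \<omega> = out_hist t \<omega>1" for \<omega>
      using mem_eqI[OF that] \<omega>1(2) by simp
    from \<omega>1 have Z: "Z (Suc t) \<omega>1 = Z (Suc t) \<omega>0" by (simp add: enc_hist_Suc_eq_iff)
    have "{\<omega>\<in>?E. out_hist t \<omega> = out_hist t \<omega>1}
        = {\<omega>\<in>space \<Omega>. enc_hist (Suc t) \<omega> = enc_hist (Suc t) \<omega>1 \<and> out_hist t \<omega> = out_hist t \<omega>1}"
      and "{\<omega>\<in>?E \<inter> ?B. out_hist t \<omega> = out_hist t \<omega>1}
        = {\<omega>\<in>space \<Omega>. (enc_hist (Suc t) \<omega> = enc_hist (Suc t) \<omega>1 \<and> out_hist t \<omega> = out_hist t \<omega>1)
            \<and> Y (Suc t) \<omega> = y}"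
      using \<omega>1(1) mem by auto
    then show "prob {\<omega>\<in>?E \<inter> ?B. out_hist t \<omega> = out_hist t \<omega>1}
        = pmf (chan (Z (Suc t) \<omega>0)) y * prob {\<omega>\<in>?E. out_hist t \<omega> = out_hist t \<omega>1}"
      using channel_step[of t \<omega>1 y] Z by (simp only:)
  qed (intro sets.sets_Collect_conj history_events)+
  moreover have "?E \<inter> ?B
      = {\<omega>\<in>space \<Omega>. enc_hist (Suc t) \<omega> = enc_hist (Suc t) \<omega>0 \<and> mem t \<omega> = m \<and> Y (Suc t) \<omega> = y}"
    by auto
  ultimately show ?thesis by simp
qed

section \<open>The belief along the encoder history\<close>

lemma encoder_AE: "AE \<omega> in \<Omega>. Z (Suc t) \<omega> = c (Suc t) (X (Suc t) \<omega>, bel t \<omega>)"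
  using encoder_law[of "Suc t"] by simp

lemma bel_product:
  "prob {\<omega>\<in>space \<Omega>. enc_hist t \<omega> = enc_hist t \<omega>0 \<and> mem t \<omega> = m}
    = bel t \<omega>0 $ m * prob {\<omega>\<in>space \<Omega>. enc_hist t \<omega> = enc_hist t \<omega>0}"
proof (rule conditional_product[OF _ enc_hist_event])
  show "\<P>(\<omega> in \<Omega>. mem t \<omega> = m \<bar> enc_hist t \<omega> = enc_hist t \<omega>0) = bel t \<omega>0 $ m"
    by (simp add: belief_def enc_hist_eq_iff)
qed

lemma bel_nonneg: "0 \<le> bel t \<omega> $ m"
  by (simp add: belief_def cond_prob_def)

text \<open>At time 0 the conditioning event is the whole space and the memory is the constant
  \<open>m0\<close>.\<close>

lemma bel_0: "bel 0 \<omega> = axis m0 1"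
  by (auto simp: belief_def cond_prob_def axis_def vec_eq_iff prob_space)

text \<open>The new source symbol carries no information about the memory beyond the past encoder
  history, and the channel input is a function of the two.\<close>

lemma bel_product_X:
  "prob {\<omega>\<in>space \<Omega>. enc_hist t \<omega> = enc_hist t \<omega>0 \<and> X (Suc t) \<omega> = x' \<and> mem t \<omega> = m}
    = bel t \<omega>0 $ m * prob {\<omega>\<in>space \<Omega>. enc_hist t \<omega> = enc_hist t \<omega>0 \<and> X (Suc t) \<omega> = x'}"
\<comment> \<open>The source law prescribes transitions from times at least 1 only; at time 0 the
  memory is deterministic and the claim is immediate.\<close>
proof (cases "t = 0")
  case True
  then show ?thesis by (auto simp: bel_0 axis_def)
next
  case False
  then have "1 \<le> t" by simp
  from source_step_mem[OF this, of \<omega>0 x' "\<lambda>_. True"] source_step_mem[OF this, of \<omega>0 x' "\<lambda>m'. m' = m"]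
  show ?thesis by (simp add: bel_product)
qed

text \<open>If the input of \<open>\<omega>0\<close> obeys the encoding rule, adding it to the
  history changes the event by a null set only, because the rule sees the new symbol and a belief
  fixed by the past. Otherwise the history has probability zero and both sides vanish.\<close>

lemma bel_product_XZ:
  "prob {\<omega>\<in>space \<Omega>. enc_hist (Suc t) \<omega> = enc_hist (Suc t) \<omega>0 \<and> mem t \<omega> = m}
    = bel t \<omega>0 $ m * prob {\<omega>\<in>space \<Omega>. enc_hist (Suc t) \<omega> = enc_hist (Suc t) \<omega>0}"
proof (cases "Z (Suc t) \<omega>0 = c (Suc t) (X (Suc t) \<omega>0, bel t \<omega>0)")
  case True
  have *: "AE \<omega> in \<Omega>. enc_hist (Suc t) \<omega> = enc_hist (Suc t) \<omega>0
      \<longleftrightarrow> enc_hist t \<omega> = enc_hist t \<omega>0 \<and> X (Suc t) \<omega> = X (Suc t) \<omega>0"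
    using encoder_AE[of t]
  proof eventually_elim
    case (elim \<omega>)
    then show ?case
      using True bel_eqI[of t \<omega> \<omega>0] by (auto simp: enc_hist_Suc_eq_iff)
  qed
  have "prob {\<omega>\<in>space \<Omega>. enc_hist (Suc t) \<omega> = enc_hist (Suc t) \<omega>0 \<and> mem t \<omega> = m}
    = prob {\<omega>\<in>space \<Omega>. enc_hist t \<omega> = enc_hist t \<omega>0 \<and> X (Suc t) \<omega> = X (Suc t) \<omega>0 \<and> mem t \<omega> = m}"
    using * by (intro measure_eq_AE sets.sets_Collect_conj history_events) auto
  moreover have "prob {\<omega>\<in>space \<Omega>. enc_hist (Suc t) \<omega> = enc_hist (Suc t) \<omega>0}
    = prob {\<omega>\<in>space \<Omega>. enc_hist t \<omega> = enc_hist t \<omega>0 \<and> X (Suc t) \<omega> = X (Suc t) \<omega>0}"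
    using * by (intro measure_eq_AE sets.sets_Collect_conj history_events) auto
  ultimately show ?thesis using bel_product_X by simp
next
  case False
  have *: "AE \<omega> in \<Omega>. enc_hist (Suc t) \<omega> \<noteq> enc_hist (Suc t) \<omega>0"
    using encoder_AE[of t]
  proof eventually_elim
    case (elim \<omega>)
    then show ?case
      using False bel_eqI[of t \<omega> \<omega>0] by (auto simp: enc_hist_Suc_eq_iff)
  qed
  have "prob {\<omega>\<in>space \<Omega>. enc_hist (Suc t) \<omega> = enc_hist (Suc t) \<omega>0 \<and> mem t \<omega> = m} = prob {}"
    using * by (intro measure_eq_AE sets.sets_Collect_conj history_events) auto
  moreover have "prob {\<omega>\<in>space \<Omega>. enc_hist (Suc t) \<omega> = enc_hist (Suc t) \<omega>0} = prob {}"
    using * by (intro measure_eq_AE sets.sets_Collect_conj history_events) auto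
  ultimately show ?thesis by simp
qed

lemma receiver_product:
  "prob {\<omega>\<in>space \<Omega>. enc_hist (Suc t) \<omega> = enc_hist (Suc t) \<omega>0 \<and> (Y (Suc t) \<omega>, mem t \<omega>) = ym}
    = nu chan (bel t \<omega>0) (Z (Suc t) \<omega>0) $ ym
      * prob {\<omega>\<in>space \<Omega>. enc_hist (Suc t) \<omega> = enc_hist (Suc t) \<omega>0}"
proof -
  obtain y m where ym: "ym = (y, m)" by (cases ym)
  have "{\<omega>\<in>space \<Omega>. enc_hist (Suc t) \<omega> = enc_hist (Suc t) \<omega>0 \<and> (Y (Suc t) \<omega>, mem t \<omega>) = ym}
      = {\<omega>\<in>space \<Omega>. enc_hist (Suc t) \<omega> = enc_hist (Suc t) \<omega>0 \<and> mem t \<omega> = m \<and> Y (Suc t) \<omega> = y}"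
    using ym by auto
  then show ?thesis
    using channel_step_mem[of t \<omega>0 m y] bel_product_XZ[of t \<omega>0 m] by (simp add: nu_def ym)
qed

lemma measurable_receiver: "(\<lambda>\<omega>. (Y (Suc t) \<omega>, mem t \<omega>)) \<in> \<Omega> \<rightarrow>\<^sub>M count_space UNIV"
  by (intro measurable_Pair_finite measurable_process measurable_mem) simp

text \<open>The update can fail on a null set: on an encoder history of probability zero
  \<open>bel (Suc t)\<close> is the zero vector, while the right-hand side may still be a
  probability vector. On a history of positive probability, sum \<open>receiver_product\<close> over
  the pairs sent to the same new memory value and cancel.\<close>

lemma belief_update:
  "AE \<omega> in \<Omega>. bel (Suc t) \<omega> = psi (nu chan (bel t \<omega>) (Z (Suc t) \<omega>)) (l (Suc t))"
  using AE_fiber_pos[OF finite_enc_hist enc_hist_event, of "Suc t"]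
proof eventually_elim
  case (elim \<omega>0)
  let ?H = "{\<omega>\<in>space \<Omega>. enc_hist (Suc t) \<omega> = enc_hist (Suc t) \<omega>0}"
  let ?q = "nu chan (bel t \<omega>0) (Z (Suc t) \<omega>0)"
  have "bel (Suc t) \<omega>0 $ m' = psi ?q (l (Suc t)) $ m'" for m'
  proof -
    let ?A = "{ym. l (Suc t) ym = m'}"
    let ?E = "\<lambda>ym. {\<omega>\<in>space \<Omega>. enc_hist (Suc t) \<omega> = enc_hist (Suc t) \<omega>0 \<and> (Y (Suc t) \<omega>, mem t \<omega>) = ym}"
    have meas: "{\<omega>\<in>space \<Omega>. (Y (Suc t) \<omega>, mem t \<omega>) = ym} \<in> events" for ym
      by (rule count_space_event[OF measurable_receiver])
    have "bel (Suc t) \<omega>0 $ m' * prob ?H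
        = prob {\<omega>\<in>space \<Omega>. enc_hist (Suc t) \<omega> = enc_hist (Suc t) \<omega>0 \<and> mem (Suc t) \<omega> = m'}"
      by (rule bel_product[symmetric])
    also have "{\<omega>\<in>space \<Omega>. enc_hist (Suc t) \<omega> = enc_hist (Suc t) \<omega>0 \<and> mem (Suc t) \<omega> = m'}
        = (\<Union>ym\<in>?A. ?E ym)"
      by auto
    also have "prob \<dots> = (\<Sum>ym\<in>?A. prob (?E ym))"
      by (intro finite_measure_finite_Union)
         (auto simp: disjoint_family_on_def intro!: sets.sets_Collect_conj enc_hist_event meas
           simp del: prod.inject)
    also have "\<dots> = psi ?q (l (Suc t)) $ m' * prob ?H"
      unfolding receiver_product psi_def by (simp add: sum_distrib_right)
    finally show ?thesis using elim by simp
  qed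
  then show ?case by (simp add: vec_eq_iff)
qed

section \<open>Integration by conditioning on the encoder history\<close>

lemma nn_integral_receiver:
  assumes "\<And>\<omega> \<omega>' ym. enc_hist (Suc t) \<omega> = enc_hist (Suc t) \<omega>' \<Longrightarrow> G \<omega> ym = G \<omega>' ym"
  shows "(\<integral>\<^sup>+\<omega>. G \<omega> (Y (Suc t) \<omega>, mem t \<omega>) \<partial>\<Omega>)
    = (\<integral>\<^sup>+\<omega>. (\<Sum>ym\<in>UNIV. ennreal (nu chan (bel t \<omega>) (Z (Suc t) \<omega>) $ ym) * G \<omega> ym) \<partial>\<Omega>)"
proof (rule nn_integral_condition[OF finite_enc_hist enc_hist_event measurable_receiver])
  fix \<omega> \<omega>' ym assume eq: "enc_hist (Suc t) \<omega> = enc_hist (Suc t) \<omega>'"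
  then show "G \<omega> ym = G \<omega>' ym" by (rule assms)
  from eq show "nu chan (bel t \<omega>) (Z (Suc t) \<omega>) $ ym = nu chan (bel t \<omega>') (Z (Suc t) \<omega>') $ ym"
    using bel_eqI[of t \<omega> \<omega>'] by (simp add: enc_hist_Suc_eq_iff)
next
  fix \<omega> ym show "0 \<le> nu chan (bel t \<omega>) (Z (Suc t) \<omega>) $ ym" by (simp add: nu_def bel_nonneg)
qed (rule receiver_product)

lemma nn_integral_source:
  assumes t: "1 \<le> t" and "\<And>\<omega> \<omega>' x. enc_hist t \<omega> = enc_hist t \<omega>' \<Longrightarrow> G \<omega> x = G \<omega>' x"
  shows "(\<integral>\<^sup>+\<omega>. G \<omega> (X (Suc t) \<omega>) \<partial>\<Omega>)
    = (\<integral>\<^sup>+\<omega>. (\<Sum>x'\<in>UNIV. ennreal (pmf (PX (X t \<omega>)) x') * G \<omega> x') \<partial>\<Omega>)"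
proof (rule nn_integral_condition[OF finite_enc_hist enc_hist_event])
  fix \<omega> \<omega>' x assume eq: "enc_hist t \<omega> = enc_hist t \<omega>'"
  then show "G \<omega> x = G \<omega>' x" by (rule assms)
  from X_eqI[OF eq t] show "pmf (PX (X t \<omega>)) x = pmf (PX (X t \<omega>')) x" by simp
next
  fix \<omega>0 x show "prob {\<omega>\<in>space \<Omega>. enc_hist t \<omega> = enc_hist t \<omega>0 \<and> X (Suc t) \<omega> = x}
      = pmf (PX (X t \<omega>0)) x * prob {\<omega>\<in>space \<Omega>. enc_hist t \<omega> = enc_hist t \<omega>0}"
    using source_step_mem[OF t, of \<omega>0 x "\<lambda>_. True"] by simp
qed (simp_all add: measurable_process)

end

section \<open>The criterion\<close>

locale controlled_realization =
  realization \<Omega> muX PX chan m0 c l X Z Y + discounted_cost PX chan \<rho> \<beta>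
  for \<Omega> :: "'o measure" and muX :: "'x::finite pmf" and PX :: "'x \<Rightarrow> 'x pmf"
    and chan :: "'z::finite \<Rightarrow> 'y::finite pmf" and m0 :: "'m::finite"
    and c :: "nat \<Rightarrow> 'x \<times> (real ^ 'm) \<Rightarrow> 'z" and l :: "nat \<Rightarrow> 'y \<times> 'm \<Rightarrow> 'm"
    and X :: "nat \<Rightarrow> 'o \<Rightarrow> 'x" and Z :: "nat \<Rightarrow> 'o \<Rightarrow> 'z" and Y :: "nat \<Rightarrow> 'o \<Rightarrow> 'y"
    and \<rho> :: "'x \<Rightarrow> 'x \<Rightarrow> real" and \<beta> :: real +
  assumes enc_rule: "1 \<le> t \<Longrightarrow> c t \<in> enc_rules"
begin

section \<open>Information states as laws of source symbol and belief\<close>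

definition pi_state :: "nat \<Rightarrow> ('x \<times> (real ^ 'm)) measure" where
  "pi_state k = pi_path PX chan c l 1 (init_state muX m0) k"

definition phi_state :: "nat \<Rightarrow> ('x \<times> (real ^ ('y \<times> 'm))) measure" where
  "phi_state k = Q chan (c (Suc k)) (pi_state k)"

lemma pi_state_0: "pi_state 0 = init_state muX m0"
  by (simp add: pi_state_def)

lemma pi_state_Suc: "pi_state (Suc k) = Qhat PX (l (Suc k)) (phi_state k)"
  by (simp add: pi_state_def phi_state_def)

lemma pi_state_info: "pi_state k \<in> info_states"
  unfolding pi_state_def
  by (intro pi_path_info_states init_state_info_states) (auto intro: enc_rule)

lemma phi_state_info: "phi_state k \<in> info_states"
  unfolding phi_state_def by (intro Q_info_states pi_state_info enc_rule) simp

text \<open>The law of the preceding state enters as a hypothesis, so that the lemma applies to the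
  induction hypothesis inside \<open>pi_state_law\<close>; \<open>phi_state_law\<close> discharges
  it afterwards.\<close>

lemma phi_state_law_if:
  assumes pi: "\<And>h. h \<in> borel_measurable belief_space \<Longrightarrow>
      (\<integral>\<^sup>+a. h a \<partial>pi_state k) = (\<integral>\<^sup>+\<omega>. h (X (Suc k) \<omega>, bel k \<omega>) \<partial>\<Omega>)"
    and h: "h \<in> borel_measurable belief_space"
  shows "(\<integral>\<^sup>+a. h a \<partial>phi_state k)
    = (\<integral>\<^sup>+\<omega>. h (X (Suc k) \<omega>, nu chan (bel k \<omega>) (Z (Suc k) \<omega>)) \<partial>\<Omega>)"
proof -
  have c: "c (Suc k) \<in> enc_rules" by (rule enc_rule) simp
  have "(\<lambda>a. h (case a of (x, p) \<Rightarrow> (x, nu chan p (c (Suc k) (x, p))))) \<in> borel_measurable belief_space"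
    using measurable_compose[OF Q_measurable[OF c] h] .
  then have "(\<lambda>a. h (fst a, nu chan (snd a) (c (Suc k) a))) \<in> borel_measurable belief_space"
    by (simp add: case_prod_beta)
  from pi[OF this] have "(\<integral>\<^sup>+a. h a \<partial>phi_state k)
      = (\<integral>\<^sup>+\<omega>. h (X (Suc k) \<omega>, nu chan (bel k \<omega>) (c (Suc k) (X (Suc k) \<omega>, bel k \<omega>))) \<partial>\<Omega>)"
    by (simp add: phi_state_def nn_integral_Q[OF c pi_state_info h])
  also have "\<dots> = (\<integral>\<^sup>+\<omega>. h (X (Suc k) \<omega>, nu chan (bel k \<omega>) (Z (Suc k) \<omega>)) \<partial>\<Omega>)"
    using encoder_AE[of k] by (intro nn_integral_cong_AE) auto
  finally show ?thesis .
qed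

text \<open>The induction follows one period of the system: encoder and channel lead to
  \<open>nu\<close>, the memory update to the new belief, the source step to the new symbol. The
  index counts steps from time 1, hence \<open>X (Suc k)\<close> goes with
  \<open>bel k\<close>.\<close>

lemma pi_state_law:
  assumes "h \<in> borel_measurable belief_space"
  shows "(\<integral>\<^sup>+a. h a \<partial>pi_state k) = (\<integral>\<^sup>+\<omega>. h (X (Suc k) \<omega>, bel k \<omega>) \<partial>\<Omega>)"
  using assms
proof (induction k arbitrary: h)
  case 0
  have "(\<integral>\<^sup>+a. h a \<partial>init_state muX m0) = (\<integral>\<^sup>+x. h (x, axis m0 1) \<partial>measure_pmf muX)"
    unfolding init_state_def using 0 by (intro nn_integral_distr init_state_measurable) simp
  also have "measure_pmf muX = distr \<Omega> (count_space UNIV) (X 1)"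
    using realization_conditions by metis
  also have "(\<integral>\<^sup>+x. h (x, axis m0 1) \<partial>distr \<Omega> (count_space UNIV) (X 1))
      = (\<integral>\<^sup>+\<omega>. h (X 1 \<omega>, axis m0 1) \<partial>\<Omega>)"
    by (intro nn_integral_distr measurable_process) auto
  finally show ?case by (simp add: bel_0 pi_state_0)
next
  case (Suc k)
  let ?h = "\<lambda>a. \<Sum>x'\<in>UNIV. ennreal (pmf (PX (fst a)) x') * h (x', psi (snd a) (l (Suc k)))"
  have "?h \<in> borel_measurable (belief_space :: ('x \<times> (real ^ ('y \<times> 'm))) measure)"
  proof (intro borel_measurable_sum borel_measurable_times_ennreal)
    fix x'
    show "(\<lambda>a. ennreal (pmf (PX (fst a)) x'))
        \<in> borel_measurable (belief_space :: ('x \<times> (real ^ ('y \<times> 'm))) measure)"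
      by (rule measurable_compose[OF measurable_belief_space_fst]) simp
    have "(\<lambda>a. (x', psi (snd a) (l (Suc k))))
        \<in> (belief_space :: ('x \<times> (real ^ ('y \<times> 'm))) measure) \<rightarrow>\<^sub>M belief_space"
    proof (rule measurable_belief_spaceI)
      show "(\<lambda>a. psi (snd a) (l (Suc k)) $ i)
          \<in> borel_measurable (belief_space :: ('x \<times> (real ^ ('y \<times> 'm))) measure)" for i
        unfolding psi_def by simp
    qed (auto simp: space_belief_space intro: psi_in_simplex)
    from measurable_compose[OF this Suc.prems]
    show "(\<lambda>a. h (x', psi (snd a) (l (Suc k))))
        \<in> borel_measurable (belief_space :: ('x \<times> (real ^ ('y \<times> 'm))) measure)" .
  qed
  note phi = phi_state_law_if[OF Suc.IH this]
  have "(\<integral>\<^sup>+a. h a \<partial>pi_state (Suc k)) = (\<integral>\<^sup>+a. ?h a \<partial>phi_state k)"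
    unfolding pi_state_Suc by (rule nn_integral_Qhat[OF phi_state_info Suc.prems])
  also have "\<dots> = (\<integral>\<^sup>+\<omega>. (\<Sum>x'\<in>UNIV. ennreal (pmf (PX (X (Suc k) \<omega>)) x')
      * h (x', psi (nu chan (bel k \<omega>) (Z (Suc k) \<omega>)) (l (Suc k)))) \<partial>\<Omega>)"
    using phi by simp
  also have "\<dots> = (\<integral>\<^sup>+\<omega>. (\<Sum>x'\<in>UNIV. ennreal (pmf (PX (X (Suc k) \<omega>)) x') * h (x', bel (Suc k) \<omega>)) \<partial>\<Omega>)"
  proof (rule nn_integral_cong_AE, use belief_update[of k] in eventually_elim)
    case (elim \<omega>)
    then show ?case by (simp only:)
  qed
  \<comment> \<open>Read backwards, this is conditioning on the encoder history up to
    \<open>Suc k\<close>, which fixes the new belief and leaves only the next symbol random.\<close>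
  also have "\<dots> = (\<integral>\<^sup>+\<omega>. h (X (Suc (Suc k)) \<omega>, bel (Suc k) \<omega>) \<partial>\<Omega>)"
  proof (rule nn_integral_source[symmetric])
    fix \<omega> \<omega>' x assume "enc_hist (Suc k) \<omega> = enc_hist (Suc k) \<omega>'"
    from bel_eqI[OF this] show "h (x, bel (Suc k) \<omega>) = h (x, bel (Suc k) \<omega>')" by simp
  qed simp
  finally show ?case .
qed

lemma phi_state_law:
  assumes "h \<in> borel_measurable belief_space"
  shows "(\<integral>\<^sup>+a. h a \<partial>phi_state k)
    = (\<integral>\<^sup>+\<omega>. h (X (Suc k) \<omega>, nu chan (bel k \<omega>) (Z (Suc k) \<omega>)) \<partial>\<Omega>)"
  using pi_state_law assms by (rule phi_state_law_if)

section \<open>Stage cost under an optimal decoder\<close>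

definition joint :: "nat \<Rightarrow> 'x \<Rightarrow> 'y \<times> 'm \<Rightarrow> real" where
  "joint k x ym = prob {\<omega>\<in>space \<Omega>. (X (Suc k) \<omega>, Y (Suc k) \<omega>, mem k \<omega>) = (x, ym)}"

lemma measurable_joint:
  "(\<lambda>\<omega>. (X (Suc k) \<omega>, Y (Suc k) \<omega>, mem k \<omega>)) \<in> \<Omega> \<rightarrow>\<^sub>M count_space UNIV"
  by (intro measurable_Pair_finite measurable_receiver measurable_process) simp

lemma expectation_joint:
  fixes r :: "'x \<Rightarrow> 'y \<times> 'm \<Rightarrow> real"
  shows "expectation (\<lambda>\<omega>. r (X (Suc k) \<omega>) (Y (Suc k) \<omega>, mem k \<omega>))
    = (\<Sum>ym\<in>UNIV. \<Sum>x\<in>UNIV. r x ym * joint k x ym)"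
proof -
  have "expectation (\<lambda>\<omega>. r (X (Suc k) \<omega>) (Y (Suc k) \<omega>, mem k \<omega>))
      = (\<Sum>(x, ym)\<in>UNIV. r x ym * joint k x ym)"
    using expectation_finite[OF measurable_joint, of "\<lambda>(x, ym). r x ym" k]
    by (simp add: joint_def case_prod_beta del: prod.inject)
  also have "\<dots> = (\<Sum>x\<in>UNIV. \<Sum>ym\<in>UNIV. r x ym * joint k x ym)"
    unfolding sum.cartesian_product by simp
  also have "\<dots> = (\<Sum>ym\<in>UNIV. \<Sum>x\<in>UNIV. r x ym * joint k x ym)"
    by (rule sum.swap)
  finally show ?thesis .
qed

text \<open>Under \<open>phi_state k\<close>, the entry \<open>q $ ym\<close> plays the part of the
  conditional probability of the receiver's pair \<open>ym\<close> given the encoder history, so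
  integrating it against a function of the source symbol yields the joint law. The computation
  passes through nonnegative integrals, where \<open>phi_state_law\<close> is available.\<close>

lemma phi_state_cost:
  "(\<integral>(x, q). \<rho> x xh * q $ ym \<partial>phi_state k) = (\<Sum>x\<in>UNIV. \<rho> x xh * joint k x ym)"
proof -
  have meas: "(\<lambda>a. \<rho> (fst a) xh * snd a $ ym)
      \<in> borel_measurable (belief_space :: ('x \<times> (real ^ ('y \<times> 'm))) measure)"
    by (intro borel_measurable_times measurable_belief_space_nth
        measurable_compose[OF measurable_belief_space_fst]) simp
  have "(\<integral>(x, q). \<rho> x xh * q $ ym \<partial>phi_state k)
      = enn2real (\<integral>\<^sup>+a. ennreal (\<rho> (fst a) xh * snd a $ ym) \<partial>phi_state k)"
    unfolding case_prod_beta
  proof (rule integral_eq_nn_integral)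
    show "(\<lambda>a. \<rho> (fst a) xh * snd a $ ym) \<in> borel_measurable (phi_state k)"
      using meas info_states_measurable_iff[OF phi_state_info] by blast
    show "AE a in phi_state k. 0 \<le> \<rho> (fst a) xh * snd a $ ym"
      using simplex_bounds(1)[OF info_states_simplex[OF phi_state_info]] rho_nonneg
      by (intro AE_I2 mult_nonneg_nonneg) blast+
  qed
  also have "(\<integral>\<^sup>+a. ennreal (\<rho> (fst a) xh * snd a $ ym) \<partial>phi_state k)
      = (\<integral>\<^sup>+\<omega>. ennreal (\<rho> (X (Suc k) \<omega>) xh * nu chan (bel k \<omega>) (Z (Suc k) \<omega>) $ ym) \<partial>\<Omega>)"
    using phi_state_law[OF measurable_compose[OF meas measurable_ennreal]] by simp
  \<comment> \<open>Writing the single entry as a sum with a selector produces the right-hand side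
    of \<open>nn_integral_receiver\<close>, which is then applied backwards.\<close>
  also have "\<dots> = (\<integral>\<^sup>+\<omega>. (\<Sum>ym'\<in>UNIV. ennreal (nu chan (bel k \<omega>) (Z (Suc k) \<omega>) $ ym')
      * (if ym' = ym then ennreal (\<rho> (X (Suc k) \<omega>) xh) else 0)) \<partial>\<Omega>)"
    by (intro nn_integral_cong)
      (simp add: if_distrib sum.delta ennreal_mult rho_nonneg nu_def bel_nonneg mult.commute cong: if_cong)
  also have "\<dots> = (\<integral>\<^sup>+\<omega>. (if (Y (Suc k) \<omega>, mem k \<omega>) = ym then ennreal (\<rho> (X (Suc k) \<omega>) xh) else 0) \<partial>\<Omega>)"
    by (rule nn_integral_receiver[symmetric]) (simp add: enc_hist_Suc_eq_iff)
  also have "\<dots> = (\<integral>\<^sup>+\<omega>. ennreal (if (Y (Suc k) \<omega>, mem k \<omega>) = ym then \<rho> (X (Suc k) \<omega>) xh else 0) \<partial>\<Omega>)"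
    by (intro nn_integral_cong) simp
  also have "enn2real \<dots> = expectation (\<lambda>\<omega>. if (Y (Suc k) \<omega>, mem k \<omega>) = ym then \<rho> (X (Suc k) \<omega>) xh else 0)"
  proof (rule integral_eq_nn_integral[symmetric])
    show "(\<lambda>\<omega>. if (Y (Suc k) \<omega>, mem k \<omega>) = ym then \<rho> (X (Suc k) \<omega>) xh else 0) \<in> borel_measurable \<Omega>"
      by (rule measurable_compose[OF measurable_joint, of "\<lambda>(x, ym'). if ym' = ym then \<rho> x xh else 0",
          unfolded prod.case]) simp
  qed (simp add: rho_nonneg)
  also have "\<dots> = (\<Sum>x\<in>UNIV. \<rho> x xh * joint k x ym)"
    by (subst expectation_joint[of "\<lambda>x ym'. if ym' = ym then \<rho> x xh else 0"])
       (simp add: if_distrib if_distribR sum.swap[of _ UNIV UNIV] cong: if_cong)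
  finally show ?thesis .
qed

text \<open>The posterior distortion times the probability \<open>p\<close> of the receiver's pair
  is the sum against \<open>joint\<close>, so for positive \<open>p\<close> both have the same
  minimizers. If \<open>p\<close> is zero, all these joint probabilities vanish and the arbitrary
  value of the decoder does no harm.\<close>

lemma decoder_minimizes:
  assumes "is_optimal_decoder \<rho> m0 l \<Omega> X Y g"
  shows "(\<Sum>x\<in>UNIV. \<rho> x (g (Suc k) ym) * joint k x ym)
    = (MIN xh\<in>UNIV. \<Sum>x\<in>UNIV. \<rho> x xh * joint k x ym)"
proof -
  obtain y m where ym: "ym = (y, m)" by (cases ym)
  define p where "p = prob {\<omega>\<in>space \<Omega>. Y (Suc k) \<omega> = y \<and> mem k \<omega> = m}"
  have joint: "joint k x ym = prob {\<omega>\<in>space \<Omega>. X (Suc k) \<omega> = x \<and> Y (Suc k) \<omega> = y \<and> mem k \<omega> = m}" for x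
    by (simp add: joint_def ym)
  have "(\<Sum>x\<in>UNIV. \<rho> x (g (Suc k) ym) * joint k x ym) \<le> (\<Sum>x\<in>UNIV. \<rho> x xh * joint k x ym)" for xh
  proof (cases "p = 0")
    case True
    have "joint k x ym \<le> p" for x
      unfolding joint p_def
      by (intro finite_measure_mono sets.sets_Collect_conj mem_event Y_event) auto
    then have "joint k x ym = 0" for x
      using True by (simp add: joint measure_le_0_iff)
    then show ?thesis by simp
  next
    case False
    then have p: "0 < p" by (simp add: p_def zero_less_measure_iff)
    let ?f = "\<lambda>xh. \<Sum>x\<in>UNIV. \<rho> x xh * \<P>(\<omega> in \<Omega>. X (Suc k) \<omega> = x \<bar> Y (Suc k) \<omega> = y \<and> mem k \<omega> = m)"
    have "is_arg_min ?f (\<lambda>xh. True) (g (Suc k) (y, m))"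
      using assms[unfolded is_optimal_decoder_def, THEN spec, of "Suc k"] p by (simp add: p_def)
    then have "?f (g (Suc k) ym) \<le> ?f xh"
      by (auto simp: is_arg_min_def ym not_less)
    moreover have "?f xh = (\<Sum>x\<in>UNIV. \<rho> x xh * joint k x ym) / p" for xh
      by (simp add: cond_prob_def joint p_def sum_divide_distrib)
    ultimately show ?thesis using p by (simp add: divide_le_cancel)
  qed
  then show ?thesis
    by (intro antisym Min.boundedI Min_le) auto
qed

lemma stage_cost:
  assumes "is_optimal_decoder \<rho> m0 l \<Omega> X Y g"
  shows "expectation (\<lambda>\<omega>. \<rho> (X (Suc k) \<omega>) (g (Suc k) (Y (Suc k) \<omega>, mem k \<omega>)))
    = rho_tilde \<rho> (phi_state k)"
  using expectation_joint[of "\<lambda>x ym. \<rho> x (g (Suc k) ym)" k]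
  by (simp add: rho_tilde_def phi_state_cost decoder_minimizes[OF assms])

text \<open>The discounted stage distortions are dominated by the geometric series with terms
  \<open>\<beta> ^ k * B\<close>, which permits exchanging expectation and series;
  \<open>stage_cost\<close> then identifies the terms.\<close>

lemma J_eq_cost_pi:
  assumes "is_optimal_decoder \<rho> m0 l \<Omega> X Y g"
  shows "J \<rho> \<beta> m0 g l \<Omega> X Y = cost_pi PX chan \<rho> \<beta> c l 1 (init_state muX m0)"
proof -
  obtain B where B: "0 \<le> B" "\<And>x xh. \<rho> x xh \<le> B" using rho_bounded by blast
  define r where "r k \<omega> = \<rho> (X (Suc k) \<omega>) (g (Suc k) (Y (Suc k) \<omega>, mem k \<omega>))" for k \<omega>
  have r: "0 \<le> r k \<omega>" "r k \<omega> \<le> B" for k \<omega>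
    by (simp_all add: r_def rho_nonneg B)
  have meas: "r k \<in> borel_measurable \<Omega>" for k
    unfolding r_def
    by (rule measurable_compose[OF measurable_joint, of "\<lambda>(x, ym). \<rho> x (g (Suc k) ym)", unfolded prod.case]) simp
  have int: "integrable \<Omega> (\<lambda>\<omega>. \<beta> ^ k * r k \<omega>)" for k
    using r meas by (intro integrable_mult_right integrable_const_bound[where B=B]) auto
  have geom: "summable (\<lambda>k. \<beta> ^ k * B)"
    using beta_pos beta_less_1 by (intro summable_mult2 summable_geometric) simp
  have bound: "norm (\<beta> ^ k * r k \<omega>) \<le> \<beta> ^ k * B" for k \<omega>
    using r beta_pos by (simp add: abs_mult mult_left_mono)
  have "J \<rho> \<beta> m0 g l \<Omega> X Y = (\<Sum>k. expectation (\<lambda>\<omega>. \<beta> ^ k * r k \<omega>))"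
    unfolding J_def r_def[symmetric]
  proof (rule integral_suminf[OF int])
    show "AE \<omega> in \<Omega>. summable (\<lambda>k. norm (\<beta> ^ k * r k \<omega>))"
      by (rule AE_I2, rule summable_comparison_test'[OF geom]) (use bound in simp)
    show "summable (\<lambda>k. expectation (\<lambda>\<omega>. norm (\<beta> ^ k * r k \<omega>)))"
    proof (rule summable_comparison_test'[OF geom])
      fix k
      have "expectation (\<lambda>\<omega>. norm (\<beta> ^ k * r k \<omega>)) \<le> \<beta> ^ k * B"
        using bound int by (intro integral_le_const) auto
      then show "norm (expectation (\<lambda>\<omega>. norm (\<beta> ^ k * r k \<omega>))) \<le> \<beta> ^ k * B"
        by simp
    qed
  qed
  also have "\<dots> = (\<Sum>k. \<beta> ^ k * rho_tilde \<rho> (phi_state k))"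
    by (simp add: r_def stage_cost[OF assms])
  finally show ?thesis by (simp add: cost_pi_def phi_state_def pi_state_def)
qed

end

theorem theorem6:
  fixes muX :: "'x::finite pmf" and PX :: "'x \<Rightarrow> 'x pmf"
    and chan :: "'z::finite \<Rightarrow> 'y::finite pmf" and m0 :: "'m::finite"
    and \<rho> :: "'x \<Rightarrow> 'x \<Rightarrow> real" and \<beta> :: real
  assumes "\<And>x xh. 0 \<le> \<rho> x xh" and "0 < \<beta>" and "\<beta> < 1"
  shows
    "(\<forall>t\<ge>1.
        (\<forall>\<pi>\<in>(info_states :: ('x \<times> (real ^ 'm)) measure set).
           0 \<le> V PX chan \<rho> \<beta> t \<pi> \<and>
           V PX chan \<rho> \<beta> t \<pi> = W_inf chan \<rho> \<beta> (Vhat PX chan \<rho> \<beta> t) \<pi>) \<and>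
        (\<forall>\<phi>\<in>(info_states :: ('x \<times> (real ^ ('y \<times> 'm))) measure set).
           0 \<le> Vhat PX chan \<rho> \<beta> t \<phi> \<and>
           Vhat PX chan \<rho> \<beta> t \<phi> = What_inf PX (V PX chan \<rho> \<beta> (Suc t)) \<phi>)) \<and>
     (\<forall>(c :: nat \<Rightarrow> 'x \<times> (real ^ 'm) \<Rightarrow> 'z) (l :: nat \<Rightarrow> 'y \<times> 'm \<Rightarrow> 'm)
        (\<pi> :: nat \<Rightarrow> ('x \<times> (real ^ 'm)) measure) (\<phi> :: nat \<Rightarrow> ('x \<times> (real ^ ('y \<times> 'm))) measure).
        \<pi> 1 = init_state muX m0 \<and>
        (\<forall>t\<ge>1. c t \<in> enc_rules \<and> \<phi> t = Q chan (c t) (\<pi> t) \<and> \<pi> (Suc t) = Qhat PX (l t) (\<phi> t) \<and>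
           W chan \<rho> \<beta> (c t) (Vhat PX chan \<rho> \<beta> t) (\<pi> t)
             = W_inf chan \<rho> \<beta> (Vhat PX chan \<rho> \<beta> t) (\<pi> t) \<and>
           What PX (l t) (V PX chan \<rho> \<beta> (Suc t)) (\<phi> t)
             = What_inf PX (V PX chan \<rho> \<beta> (Suc t)) (\<phi> t)) \<longrightarrow>
        (\<forall>c' l'. (\<forall>t\<ge>1. c' t \<in> enc_rules) \<longrightarrow>
           cost_pi PX chan \<rho> \<beta> c l 1 (init_state muX m0)
             \<le> cost_pi PX chan \<rho> \<beta> c' l' 1 (init_state muX m0) \<and>
           (\<forall>(\<Omega> :: 'o measure) X Z Y g (\<Omega>' :: 'p measure) X' Z' Y' g'.
              is_realization muX PX chan m0 c l \<Omega> X Z Y \<and>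
              is_optimal_decoder \<rho> m0 l \<Omega> X Y g \<and>
              is_realization muX PX chan m0 c' l' \<Omega>' X' Z' Y' \<and>
              is_optimal_decoder \<rho> m0 l' \<Omega>' X' Y' g' \<longrightarrow>
              J \<rho> \<beta> m0 g l \<Omega> X Y \<le> J \<rho> \<beta> m0 g' l' \<Omega>' X' Y')))"
proof -
  interpret discounted_cost PX chan \<rho> \<beta>
    using assms by unfold_locales
  \<comment> \<open>The type of the sample space is kept generic, because the two realizations to be
    compared live on different spaces.\<close>
  have J: "J \<rho> \<beta> m0 g l \<Omega> X Y = cost_pi PX chan \<rho> \<beta> c l 1 (init_state muX m0)"
    if "is_realization muX PX chan m0 c l \<Omega> X Z Y" "is_optimal_decoder \<rho> m0 l \<Omega> X Y g"
      "\<And>t. 1 \<le> t \<Longrightarrow> c t \<in> enc_rules"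
    for \<Omega> :: "'q measure" and c :: "nat \<Rightarrow> 'x \<times> (real ^ 'm) \<Rightarrow> 'z" and l :: "nat \<Rightarrow> 'y \<times> 'm \<Rightarrow> 'm"
      and X Z Y g
  proof -
    interpret prob_space \<Omega> using that(1) by (simp add: is_realization_def)
    interpret controlled_realization \<Omega> muX PX chan m0 c l X Z Y \<rho> \<beta>
      using that by unfold_locales
    show ?thesis by (rule J_eq_cost_pi[OF that(2)])
  qed
  show ?thesis
  proof (intro conjI allI ballI impI)
    fix c c' :: "nat \<Rightarrow> 'x \<times> (real ^ 'm) \<Rightarrow> 'z" and l l' :: "nat \<Rightarrow> 'y \<times> 'm \<Rightarrow> 'm"
      and \<pi> :: "nat \<Rightarrow> ('x \<times> (real ^ 'm)) measure" and \<phi> :: "nat \<Rightarrow> ('x \<times> (real ^ ('y \<times> 'm))) measure"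
    assume *: "\<pi> 1 = init_state muX m0 \<and>
        (\<forall>t\<ge>1. c t \<in> enc_rules \<and> \<phi> t = Q chan (c t) (\<pi> t) \<and> \<pi> (Suc t) = Qhat PX (l t) (\<phi> t) \<and>
           W chan \<rho> \<beta> (c t) (Vhat PX chan \<rho> \<beta> t) (\<pi> t)
             = W_inf chan \<rho> \<beta> (Vhat PX chan \<rho> \<beta> t) (\<pi> t) \<and>
           What PX (l t) (V PX chan \<rho> \<beta> (Suc t)) (\<phi> t)
             = What_inf PX (V PX chan \<rho> \<beta> (Suc t)) (\<phi> t))"
      and c': "\<forall>t\<ge>1. c' t \<in> enc_rules"
    then have \<pi>1: "\<pi> 1 = init_state muX m0" by blast
    have "cost_pi PX chan \<rho> \<beta> c l 1 (\<pi> 1) \<le> cost_pi PX chan \<rho> \<beta> c' l' 1 (\<pi> 1)"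
    proof (rule stagewise_minimizers_optimal[where \<pi>=\<pi> and \<phi>=\<phi>])
      show "\<pi> 1 \<in> info_states" unfolding \<pi>1 by (rule init_state_info_states)
    qed (use * c' in blast)+
    then show le: "cost_pi PX chan \<rho> \<beta> c l 1 (init_state muX m0)
        \<le> cost_pi PX chan \<rho> \<beta> c' l' 1 (init_state muX m0)"
      unfolding \<pi>1 .
    fix \<Omega> :: "'o measure" and X Z Y g and \<Omega>' :: "'p measure" and X' Z' Y' g'
    assume "is_realization muX PX chan m0 c l \<Omega> X Z Y \<and>
        is_optimal_decoder \<rho> m0 l \<Omega> X Y g \<and>
        is_realization muX PX chan m0 c' l' \<Omega>' X' Z' Y' \<and>
        is_optimal_decoder \<rho> m0 l' \<Omega>' X' Y' g'"
    then show "J \<rho> \<beta> m0 g l \<Omega> X Y \<le> J \<rho> \<beta> m0 g' l' \<Omega>' X' Y'"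
      using J[of c l \<Omega> X Z Y g] J[of c' l' \<Omega>' X' Z' Y' g'] le * c' by simp
  qed (rule V_nonneg V_eq_W_inf Vhat_nonneg Vhat_eq_What_inf; assumption)+
qed

end
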